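(* Let $\alpha>1/2$ and $1/2<\xi<\alpha$ be constants. For each $n$, let $q=q_n$ be an integer with $1\le q<n$ such that, as $n\to\infty$, $q\to\infty$ and $q=o(n)$. Let $\bm{\beta}_0=\bm{\beta}_0^{(n)}\in\mathbb{R}^n$ be a vector with exactly $q$ nonzero entries, suppose $\mathbf{y}\sim\mathcal{N}_n(\bm{\beta}_0,\mathbf{I}_n)$, and let $\Pi(\cdot\mid\mathbf{y})$ be the GLT posterior on $\mathbb{R}^n$ with global scale $\tau=(q/n)^{\alpha}$ and shape $\xi$. Then, for every sequence $M_n\to\infty$, $$\mathbb{E}_{\bm{\beta}_0}\,\Pi\left(\|\bm{\beta}-\bm{\beta}_0\|_2^2\ge M_n\, q\log(n/q)\;\middle|\;\mathbf{y}\right)\longrightarrow 0$$ as $n\to\infty$.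
   Context: Sparse normal means model with the GLT prior. The observation is $\mathbf{y}=(y_1,\dots,y_n)^\top$, modelled as $y_i\mid\beta_i\sim\mathcal{N}(\beta_i,1)$ independently. The prior is: independently for $i=1,\dots,n$, $\beta_i\mid\lambda_i\sim\mathcal{N}(0,\lambda_i^2)$ and $\lambda_i\sim\mathcal{GPD}(\tau,\xi)$, with fixed (deterministic) $0<\tau<1/2$ and $\xi>1/2$, where $\mathcal{GPD}(\tau,\xi)$ is the generalized Pareto distribution with density $\frac1\tau\left(1+\frac{\xi\lambda}{\tau}\right)^{-(1/\xi+1)}$ on $\lambda\in(0,\infty)$. $\Pi(\cdot\mid\mathbf{y})$ is the resulting posterior distribution of $\bm{\beta}=(\beta_1,\dots,\beta_n)^\top$ (a product over coordinates). $\mathbb{E}_{\bm{\beta}_0}$ is expectation over $\mathbf{y}\sim\mathcal{N}_n(\bm{\beta}_0,\mathbf{I}_n)$. Since $q/n\to0$, $\tau=(q/n)^\alpha<1/2$ for all large $n$. *)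

theory Defs
  imports "HOL-Probability.Probability" "HOL-Library.Landau_Symbols"
begin

text \<open>
  Vectors in \<open>\<real>\<^sup>n\<close>, where \<open>n\<close> varies, are functions \<open>nat \<Rightarrow> real\<close> read on the index set
  \<open>{..<n}\<close>; measures on \<open>\<real>\<^sup>n\<close> live on the product space \<open>\<Pi>\<^sub>M i\<in>{..<n}. borel\<close>.
\<close>

text \<open>Parametrised by the standard deviation, as is \<^const>\<open>normal_density\<close>.\<close>

definition normal_dist :: "real \<Rightarrow> real \<Rightarrow> real measure" where
  "normal_dist m s = density lborel (\<lambda>x. ennreal (normal_density m s x))"

definition gpd_density :: "real \<Rightarrow> real \<Rightarrow> real \<Rightarrow> real" where
  "gpd_density \<tau> \<xi> l =
     (if 0 < l then 1 / \<tau> * (1 + \<xi> * l / \<tau>) powr (- (1 / \<xi> + 1)) else 0)"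

definition gpd :: "real \<Rightarrow> real \<Rightarrow> real measure" where
  "gpd \<tau> \<xi> = density lborel (\<lambda>l. ennreal (gpd_density \<tau> \<xi> l))"

text \<open>
  Marginal prior of one coefficient \<open>\<beta>\<^sub>i\<close> in the hierarchy
  \<open>\<lambda>\<^sub>i \<sim> GPD(\<tau>, \<xi>)\<close>, \<open>\<beta>\<^sub>i | \<lambda>\<^sub>i \<sim> N(0, \<lambda>\<^sub>i\<^sup>2)\<close>.
\<close>

definition glt_prior1 :: "real \<Rightarrow> real \<Rightarrow> real measure" where
  "glt_prior1 \<tau> \<xi> = gpd \<tau> \<xi> \<bind> normal_dist 0"

definition glt_prior :: "nat \<Rightarrow> real \<Rightarrow> real \<Rightarrow> (nat \<Rightarrow> real) measure" where
  "glt_prior n \<tau> \<xi> = (\<Pi>\<^sub>M i\<in>{..<n}. glt_prior1 \<tau> \<xi>)"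

definition normal_means :: "nat \<Rightarrow> (nat \<Rightarrow> real) \<Rightarrow> (nat \<Rightarrow> real) measure" where
  "normal_means n \<beta> = (\<Pi>\<^sub>M i\<in>{..<n}. normal_dist (\<beta> i) 1)"

text \<open>Density of \<^term>\<open>normal_means n \<beta>\<close> at \<open>y\<close> with respect to Lebesgue measure.\<close>

definition likelihood :: "nat \<Rightarrow> (nat \<Rightarrow> real) \<Rightarrow> (nat \<Rightarrow> real) \<Rightarrow> real" where
  "likelihood n y \<beta> = (\<Prod>i<n. normal_density (\<beta> i) 1 (y i))"

text \<open>The posterior by Bayes' formula; it is normalised, see \<open>prob_space_glt_posterior\<close>.\<close>

definition glt_posterior ::
    "nat \<Rightarrow> real \<Rightarrow> real \<Rightarrow> (nat \<Rightarrow> real) \<Rightarrow> (nat \<Rightarrow> real) measure" where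
  "glt_posterior n \<tau> \<xi> y =
     density (glt_prior n \<tau> \<xi>)
       (\<lambda>\<beta>. ennreal (likelihood n y \<beta> / (\<integral>b. likelihood n y b \<partial>glt_prior n \<tau> \<xi>)))"

definition sq_dist :: "nat \<Rightarrow> (nat \<Rightarrow> real) \<Rightarrow> (nat \<Rightarrow> real) \<Rightarrow> real" where
  "sq_dist n b c = (\<Sum>i<n. (b i - c i)\<^sup>2)"

lemma sets_normal_dist [simp, measurable_cong]: "sets (normal_dist m s) = sets borel"
  by (simp add: normal_dist_def)

lemma space_normal_dist [simp]: "space (normal_dist m s) = UNIV"
  by (simp add: normal_dist_def)

lemma prob_space_normal_dist: "s \<noteq> 0 \<Longrightarrow> prob_space (normal_dist m s)"
proof -
  assume "s \<noteq> 0"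
  then have "normal_density m s = normal_density m \<bar>s\<bar>" "\<bar>s\<bar> > 0"
    by (auto simp: normal_density_def fun_eq_iff)
  then show ?thesis
    using prob_space_normal_density[of "\<bar>s\<bar>" m] by (simp add: normal_dist_def)
qed

lemma normal_dist_kernel [measurable]: "normal_dist m \<in> borel \<rightarrow>\<^sub>M subprob_algebra borel"
proof (rule measurable_subprob_algebra)
  fix s :: real
  show "subprob_space (normal_dist m s)"
  proof (cases "s = 0")
    case True
    then show ?thesis
      by (intro subprob_spaceI) (auto simp: normal_dist_def normal_density_def emeasure_density)
  qed (simp add: prob_space_normal_dist prob_space_imp_subprob_space)
next
  fix A :: "real set" assume [measurable]: "A \<in> sets borel"
  have [measurable]: "(\<lambda>(s, x). normal_density m s x) \<in> borel_measurable (borel \<Otimes>\<^sub>M borel)"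
    unfolding normal_density_def by measurable
  show "(\<lambda>s. emeasure (normal_dist m s) A) \<in> borel_measurable borel"
    by (simp add: normal_dist_def emeasure_density)
qed simp

lemma sets_gpd [simp, measurable_cong]: "sets (gpd \<tau> \<xi>) = sets borel"
  by (simp add: gpd_def)

lemma space_gpd [simp]: "space (gpd \<tau> \<xi>) = UNIV"
  by (simp add: gpd_def)

lemma prob_space_gpd:
  assumes "\<tau> > 0" "\<xi> > 0"
  shows "prob_space (gpd \<tau> \<xi>)"
proof
  define f where "f l = 1 / \<tau> * (1 + \<xi> * l / \<tau>) powr (- (1 / \<xi> + 1))" for l
  define F where "F l = - ((1 + \<xi> * l / \<tau>) powr (- (1 / \<xi>)))" for l
  have [measurable]: "f \<in> borel_measurable borel" "gpd_density \<tau> \<xi> \<in> borel_measurable borel"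
    unfolding f_def[abs_def] gpd_density_def[abs_def] by measurable
  have pos: "1 + \<xi> * l / \<tau> > 0" if "l \<ge> 0" for l
    using assms that by (simp add: add_pos_nonneg)
  have "(\<integral>\<^sup>+l. ennreal (f l) * indicator {0..} l \<partial>lborel) = ennreal (0 - F 0)"
  proof (rule nn_integral_FTC_atLeast)
    fix l :: real assume "0 \<le> l"
    note p = pos[OF this]
    have "((\<lambda>l. 1 + \<xi> * l / \<tau>) has_real_derivative 0 + \<xi> * 1 / \<tau>) (at l)"
      by (intro DERIV_add DERIV_const DERIV_cdivide DERIV_cmult DERIV_ident)
    from DERIV_fun_powr[OF this p, of "- (1 / \<xi>)"]
    have "DERIV F l :> - (- (1 / \<xi>) * (1 + \<xi> * l / \<tau>) powr (- (1 / \<xi>) - 1) * (\<xi> / \<tau>))"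
      unfolding F_def by (intro DERIV_minus) (simp only: of_nat_1 add_0 mult_1_right)
    also have "- (- (1 / \<xi>) * (1 + \<xi> * l / \<tau>) powr (- (1 / \<xi>) - 1) * (\<xi> / \<tau>)) = f l"
      using assms by (simp add: f_def)
    finally show "DERIV F l :> f l" .
    show "0 \<le> f l" using assms by (simp add: f_def)
  next
    have "filterlim (\<lambda>l. \<xi> / \<tau> * l) at_top at_top"
      using assms by (intro filterlim_tendsto_pos_mult_at_top[OF tendsto_const _ filterlim_ident]) simp
    then have "filterlim (\<lambda>l. 1 + \<xi> / \<tau> * l) at_top at_top"
      by (rule filterlim_tendsto_add_at_top[OF tendsto_const])
    then have "((\<lambda>l. (1 + \<xi> / \<tau> * l) powr (- (1 / \<xi>))) \<longlongrightarrow> 0) at_top"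
      using assms by (intro tendsto_neg_powr) simp_all
    then have "((\<lambda>l. - ((1 + \<xi> / \<tau> * l) powr (- (1 / \<xi>)))) \<longlongrightarrow> - 0) at_top"
      by (rule tendsto_minus)
    then show "(F \<longlongrightarrow> 0) at_top"
      by (simp add: F_def[abs_def])
  qed measurable
  moreover have "(\<integral>\<^sup>+l. ennreal (gpd_density \<tau> \<xi> l) \<partial>lborel)
      = (\<integral>\<^sup>+l. ennreal (f l) * indicator {0..} l \<partial>lborel)"
    using AE_lborel_singleton[of "0::real"]
    by (intro nn_integral_cong_AE) (auto elim!: eventually_mono
        simp: gpd_density_def f_def indicator_def)
  ultimately show "emeasure (gpd \<tau> \<xi>) (space (gpd \<tau> \<xi>)) = 1"
    by (simp add: gpd_def emeasure_density F_def)
qed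

lemma normal_dist_gpd_kernel [measurable]: "normal_dist 0 \<in> gpd \<tau> \<xi> \<rightarrow>\<^sub>M subprob_algebra borel"
  by measurable

lemma sets_glt_prior1 [simp, measurable_cong]: "sets (glt_prior1 \<tau> \<xi>) = sets borel"
  unfolding glt_prior1_def by (rule sets_bind) auto

lemma space_glt_prior1 [simp]: "space (glt_prior1 \<tau> \<xi>) = UNIV"
  using sets_eq_imp_space_eq[OF sets_glt_prior1] by simp

lemma prob_space_glt_prior1:
  assumes "\<tau> > 0" "\<xi> > 0"
  shows "prob_space (glt_prior1 \<tau> \<xi>)"
proof -
  interpret prob_space "gpd \<tau> \<xi>" by (rule prob_space_gpd) fact+
  have [measurable]: "gpd_density \<tau> \<xi> \<in> borel_measurable borel"
    unfolding gpd_density_def[abs_def] by measurable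
  have "AE l in gpd \<tau> \<xi>. prob_space (normal_dist 0 l)"
    unfolding gpd_def
    by (subst AE_density) (auto intro!: AE_I2 prob_space_normal_dist simp: gpd_density_def)
  then show ?thesis
    unfolding glt_prior1_def by (rule prob_space_bind) (rule normal_dist_gpd_kernel)
qed

lemma sets_glt_prior [simp, measurable_cong]:
  "sets (glt_prior n \<tau> \<xi>) = sets (\<Pi>\<^sub>M i\<in>{..<n}. borel)"
  unfolding glt_prior_def by (intro sets_PiM_cong) auto

lemma sets_normal_means [simp, measurable_cong]:
  "sets (normal_means n \<beta>) = sets (\<Pi>\<^sub>M i\<in>{..<n}. borel)"
  unfolding normal_means_def by (intro sets_PiM_cong) auto

lemma sets_glt_posterior [simp, measurable_cong]:
  "sets (glt_posterior n \<tau> \<xi> y) = sets (\<Pi>\<^sub>M i\<in>{..<n}. borel)"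
  by (simp add: glt_posterior_def)

lemma prob_space_glt_prior: "\<tau> > 0 \<Longrightarrow> \<xi> > 0 \<Longrightarrow> prob_space (glt_prior n \<tau> \<xi>)"
  unfolding glt_prior_def by (intro prob_space_PiM prob_space_glt_prior1)

lemma prob_space_normal_means: "prob_space (normal_means n \<beta>)"
  unfolding normal_means_def by (intro prob_space_PiM prob_space_normal_dist) simp

lemma likelihood_measurable [measurable]:
  "(\<lambda>(y, \<beta>). likelihood n y \<beta>)
     \<in> borel_measurable ((\<Pi>\<^sub>M i\<in>{..<n}. borel) \<Otimes>\<^sub>M (\<Pi>\<^sub>M i\<in>{..<n}. borel))"
  unfolding likelihood_def normal_density_def by measurable

lemma likelihood_measurable2 [measurable]:
  "likelihood n y \<in> borel_measurable (\<Pi>\<^sub>M i\<in>{..<n}. borel)"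
  unfolding likelihood_def[abs_def] normal_density_def by measurable

lemma likelihood_pos: "0 < likelihood n y \<beta>"
  unfolding likelihood_def by (intro prod_pos normal_density_pos) auto

lemma likelihood_le_1: "likelihood n y \<beta> \<le> 1"
  unfolding likelihood_def
proof (intro prod_le_1 conjI normal_density_nonneg)
  fix i
  have "1 \<le> sqrt (2 * pi)" using pi_ge_two by (simp add: real_le_rsqrt)
  then show "normal_density (\<beta> i) 1 (y i) \<le> 1"
    unfolding normal_density_def by (simp add: divide_le_eq order_trans[of _ 1])
qed

context
  fixes \<tau> \<xi> :: real and n :: nat
  assumes params: "\<tau> > 0" "\<xi> > 0"
begin

lemma integrable_likelihood: "integrable (glt_prior n \<tau> \<xi>) (likelihood n y)"
proof -
  interpret prob_space "glt_prior n \<tau> \<xi>" using params by (rule prob_space_glt_prior)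
  show ?thesis
    by (rule integrable_const_bound[where B = 1])
      (auto simp: likelihood_le_1 abs_of_pos likelihood_pos)
qed

lemma evidence_pos: "0 < (\<integral>b. likelihood n y b \<partial>glt_prior n \<tau> \<xi>)"
proof -
  interpret prob_space "glt_prior n \<tau> \<xi>" using params by (rule prob_space_glt_prior)
  show ?thesis
    using expectation_less[of "likelihood n y" 0] integral_less_AE_space[of "\<lambda>_. 0" "likelihood n y"]
    by (simp add: integrable_likelihood likelihood_pos emeasure_space_1)
qed

lemma prob_space_glt_posterior: "prob_space (glt_posterior n \<tau> \<xi> y)"
proof
  let ?P = "glt_prior n \<tau> \<xi>" and ?Z = "\<integral>b. likelihood n y b \<partial>glt_prior n \<tau> \<xi>"
  have "(\<integral>\<^sup>+\<beta>. ennreal (likelihood n y \<beta> / ?Z) \<partial>?P)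
      = ennreal (\<integral>\<beta>. likelihood n y \<beta> / ?Z \<partial>?P)"
    using integrable_likelihood evidence_pos
    by (intro nn_integral_eq_integral) (auto intro!: AE_I2 simp: less_imp_le likelihood_pos)
  also have "\<dots> = 1" using evidence_pos[of y] by simp
  finally have *: "(\<integral>\<^sup>+\<beta>. ennreal (likelihood n y \<beta> / ?Z) \<partial>?P) = 1" .
  have [measurable]: "(\<lambda>\<beta>. ennreal (likelihood n y \<beta> / ?Z)) \<in> borel_measurable ?P"
    by measurable
  have "emeasure (glt_posterior n \<tau> \<xi> y) (space ?P)
      = (\<integral>\<^sup>+\<beta>. ennreal (likelihood n y \<beta> / ?Z) * indicator (space ?P) \<beta> \<partial>?P)"
    unfolding glt_posterior_def by (rule emeasure_density) (fact, rule sets.top)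
  also have "\<dots> = (\<integral>\<^sup>+\<beta>. ennreal (likelihood n y \<beta> / ?Z) \<partial>?P)"
    by (rule nn_integral_cong) simp
  finally show "emeasure (glt_posterior n \<tau> \<xi> y) (space (glt_posterior n \<tau> \<xi> y)) = 1"
    unfolding * by (simp add: glt_posterior_def)
qed

text \<open>Hence posterior probabilities are integrable under \<^term>\<open>normal_means n \<beta>\<close>.\<close>

lemma measurable_posterior_prob:
  assumes [measurable]: "A \<in> sets (\<Pi>\<^sub>M i\<in>{..<n}. borel)"
  shows "(\<lambda>y. measure (glt_posterior n \<tau> \<xi> y) A) \<in> borel_measurable (\<Pi>\<^sub>M i\<in>{..<n}. borel)"
proof -
  interpret prob_space "glt_prior n \<tau> \<xi>" using params by (rule prob_space_glt_prior)
  show ?thesis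
    unfolding measure_def glt_posterior_def by (simp add: emeasure_density)
qed

end

end

theory Submission
  imports Defs
begin

text \<open>
  By Markov's inequality it is enough that the expected posterior second moment of
  \<open>\<beta> - \<beta>\<^sub>0\<close> is \<open>O(q log (n/q))\<close>, and since the posterior is a product this is a sum of
  one-dimensional risks. Given \<open>l\<close>, a coefficient is a posteriori normal with mean \<open>k y\<close> and
  variance \<open>k = l\<^sup>2 / (1 + l\<^sup>2)\<close>, and \<open>y\<close> has marginal variance \<open>1 + l\<^sup>2\<close>.

  Signals: the posterior second moment of \<open>\<beta> - y\<close> is \<open>O(1 + log (1/\<tau>))\<close> uniformly in \<open>y\<close>.
  Only those \<open>l\<close> with \<open>y\<^sup>2 / (1 + l\<^sup>2) > 8 (1 + log (1/\<tau>))\<close> can violate this, and their contribution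
  \<open>O(\<tau>\<^bsup>1/\<xi>\<^esup> / \<bar>y\<bar>\<^sup>3)\<close> is dominated by the marginal density of \<open>y\<close>, because the prior puts
  enough mass on \<open>l \<in> [\<bar>y\<bar>, 2 \<bar>y\<bar>]\<close>; this uses \<open>1/\<xi> < 2\<close>.

  Noise: the posterior second moment is at most \<open>(1 + y\<^sup>2) E[k | y]\<close>. For \<open>\<bar>y\<bar> \<le> T\<close> the
  marginal density of \<open>y\<close> dominates the standard normal one, so Fubini bounds the risk by the prior mean
  of \<open>k \<le> l\<^bsup>1/\<alpha>\<^esup>\<close>, which is \<open>O(\<tau>\<^bsup>1/\<alpha>\<^esup>) = O(q/n)\<close> since \<open>\<xi> < \<alpha>\<close>. For \<open>\<bar>y\<bar> > T\<close> one uses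
  \<open>k \<le> 1\<close> and the normal tail, with \<open>T\<^sup>2 = 2 log (n/q)\<close>.
\<close>

section \<open>Gaussian moments, conjugacy, and reduction to an integral over the scale\<close>

lemma borel_measurable_normal_density_param [measurable]:
  assumes [measurable]: "f \<in> borel_measurable M" "g \<in> borel_measurable M" "h \<in> borel_measurable M"
  shows "(\<lambda>x. normal_density (f x) (g x) (h x)) \<in> borel_measurable M"
  unfolding normal_density_def by measurable

lemma nn_integral_normal_second_moment:
  assumes "0 < \<sigma>"
  shows "(\<integral>\<^sup>+x. ennreal ((x - c)\<^sup>2 * normal_density \<mu> \<sigma> x) \<partial>lborel) = ennreal (\<sigma>\<^sup>2 + (\<mu> - c)\<^sup>2)"
proof -
  have 2: "has_bochner_integral lborel (\<lambda>x. normal_density \<mu> \<sigma> x * (x - \<mu>)\<^sup>2) (\<sigma>\<^sup>2)"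
    using normal_moment_even[OF assms, of \<mu> 1] by (simp add: fact_numeral)
  have 1: "has_bochner_integral lborel (\<lambda>x. normal_density \<mu> \<sigma> x * (x - \<mu>)) 0"
    using normal_moment_odd[OF assms, of \<mu> 0] by simp
  have 0: "has_bochner_integral lborel (normal_density \<mu> \<sigma>) 1"
    using assms by (simp add: has_bochner_integral_iff integrable_normal_density)
  have "has_bochner_integral lborel
      (\<lambda>x. normal_density \<mu> \<sigma> x * (x - \<mu>)\<^sup>2 + (2 * (\<mu> - c)) * (normal_density \<mu> \<sigma> x * (x - \<mu>))
        + (\<mu> - c)\<^sup>2 * normal_density \<mu> \<sigma> x) (\<sigma>\<^sup>2 + 2 * (\<mu> - c) * 0 + (\<mu> - c)\<^sup>2 * 1)"
    by (intro has_bochner_integral_add has_bochner_integral_mult_right 0 1 2)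
  also have "(\<lambda>x. normal_density \<mu> \<sigma> x * (x - \<mu>)\<^sup>2 + (2 * (\<mu> - c)) * (normal_density \<mu> \<sigma> x * (x - \<mu>))
        + (\<mu> - c)\<^sup>2 * normal_density \<mu> \<sigma> x) = (\<lambda>x. (x - c)\<^sup>2 * normal_density \<mu> \<sigma> x)"
    by (intro ext) (simp add: power2_eq_square algebra_simps)
  finally show ?thesis
    by (subst nn_integral_eq_integral) (auto simp: has_bochner_integral_iff)
qed

text \<open>Completing the square in \<open>b\<close>. Both sides are the joint density of
  coefficient and observation given the scale \<open>l\<close>; the right-hand side conditions on
  \<open>y\<close>, so that integrals over \<open>b\<close> become Gaussian moments.\<close>

lemma normal_density_conjugate:
  assumes "0 < l"
  shows "normal_density b 1 y * normal_density 0 l b =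
    normal_density 0 (sqrt (1 + l\<^sup>2)) y *
      normal_density (l\<^sup>2 / (1 + l\<^sup>2) * y) (l / sqrt (1 + l\<^sup>2)) b"
proof -
  define s where "s = 1 + l\<^sup>2"
  have s: "0 < s" by (simp add: s_def add_pos_nonneg)
  have e: "- (y - b)\<^sup>2 / 2 + - (b\<^sup>2) / (2 * l\<^sup>2)
      = - (y\<^sup>2) / (2 * s) + - (b - l\<^sup>2 / s * y)\<^sup>2 / (2 * (l\<^sup>2 / s))"
  proof -
    have "(b - l\<^sup>2 / s * y)\<^sup>2 / (2 * (l\<^sup>2 / s)) = s * b\<^sup>2 / (2 * l\<^sup>2) - b * y + l\<^sup>2 * y\<^sup>2 / (2 * s)"
      using s assms by (simp add: power2_diff divide_simps) (simp add: power_numeral_reduce algebra_simps)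
    moreover have "s * b\<^sup>2 / (2 * l\<^sup>2) = b\<^sup>2 / (2 * l\<^sup>2) + b\<^sup>2 / 2"
      using assms by (simp add: s_def divide_simps) (simp add: algebra_simps)
    moreover have "y\<^sup>2 / (2 * s) + l\<^sup>2 * y\<^sup>2 / (2 * s) = y\<^sup>2 / 2"
      using s unfolding s_def by (simp add: divide_simps) (simp add: algebra_simps)
    ultimately show ?thesis by (simp add: power2_diff algebra_simps add_divide_distrib diff_divide_distrib)
  qed
  have "normal_density b 1 y * normal_density 0 l b
      = 1 / (sqrt (2 * pi) * sqrt (2 * pi * l\<^sup>2)) * exp (- (y - b)\<^sup>2 / 2 + - (b\<^sup>2) / (2 * l\<^sup>2))"
    by (simp only: normal_density_def exp_add) simp
  also have "sqrt (2 * pi) * sqrt (2 * pi * l\<^sup>2) = sqrt (2 * pi * s) * sqrt (2 * pi * (l\<^sup>2 / s))"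
    using s by (simp add: real_sqrt_mult real_sqrt_divide)
  finally show ?thesis
    unfolding e exp_add using s by (simp add: normal_density_def power_divide flip: s_def)
qed

text \<open>At \<open>l = 0\<close> the function \<open>normal_density 0 0\<close> vanishes
  identically by division by zero, so the integrals over \<open>b\<close> below have their stated
  values only for positive \<open>l\<close>.\<close>

lemma AE_gpd_pos: "AE l in gpd \<tau> \<xi>. 0 < l"
proof -
  have [measurable]: "gpd_density \<tau> \<xi> \<in> borel_measurable borel"
    unfolding gpd_density_def[abs_def] by measurable
  show ?thesis
    unfolding gpd_def by (subst AE_density) (auto simp: gpd_density_def)
qed

lemma nn_integral_glt_prior1:
  assumes [measurable]: "h \<in> borel_measurable borel"
  shows "(\<integral>\<^sup>+b. h b \<partial>glt_prior1 \<tau> \<xi>)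
    = (\<integral>\<^sup>+l. \<integral>\<^sup>+b. ennreal (normal_density 0 l b) * h b \<partial>lborel \<partial>gpd \<tau> \<xi>)"
  unfolding glt_prior1_def
  by (subst nn_integral_bind[where B = borel])
    (auto simp: normal_dist_def nn_integral_density intro!: nn_integral_cong)

text \<open>For fixed \<open>l\<close>, conjugacy turns the integral over \<open>b\<close> into a
  Gaussian second moment about \<open>c\<close>: variance plus squared bias. What remains is a
  single integral over the scale, and the later estimates work on that form.\<close>

lemma nn_integral_glt_prior1_sq:
  "(\<integral>\<^sup>+b. ennreal ((b - c)\<^sup>2 * normal_density b 1 y) \<partial>glt_prior1 \<tau> \<xi>)
    = (\<integral>\<^sup>+l. ennreal (normal_density 0 (sqrt (1 + l\<^sup>2)) y *
        (l\<^sup>2 / (1 + l\<^sup>2) + (l\<^sup>2 / (1 + l\<^sup>2) * y - c)\<^sup>2)) \<partial>gpd \<tau> \<xi>)"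
proof -
  have "(\<integral>\<^sup>+b. ennreal (normal_density 0 l b) * ennreal ((b - c)\<^sup>2 * normal_density b 1 y) \<partial>lborel)
      = ennreal (normal_density 0 (sqrt (1 + l\<^sup>2)) y *
          (l\<^sup>2 / (1 + l\<^sup>2) + (l\<^sup>2 / (1 + l\<^sup>2) * y - c)\<^sup>2))" if "0 < l" for l
  proof -
    let ?k = "l\<^sup>2 / (1 + l\<^sup>2)" and ?v = "normal_density 0 (sqrt (1 + l\<^sup>2)) y"
    have "(\<integral>\<^sup>+b. ennreal (normal_density 0 l b) * ennreal ((b - c)\<^sup>2 * normal_density b 1 y) \<partial>lborel)
        = (\<integral>\<^sup>+b. ennreal ?v * ennreal ((b - c)\<^sup>2 * normal_density (?k * y) (l / sqrt (1 + l\<^sup>2)) b) \<partial>lborel)"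
    proof (intro nn_integral_cong)
      fix b
      have "normal_density 0 l b * ((b - c)\<^sup>2 * normal_density b 1 y)
          = (b - c)\<^sup>2 * (normal_density b 1 y * normal_density 0 l b)" by simp
      also have "\<dots> = ?v * ((b - c)\<^sup>2 * normal_density (?k * y) (l / sqrt (1 + l\<^sup>2)) b)"
        unfolding normal_density_conjugate[OF that] by simp
      finally show "ennreal (normal_density 0 l b) * ennreal ((b - c)\<^sup>2 * normal_density b 1 y)
        = ennreal ?v * ennreal ((b - c)\<^sup>2 * normal_density (?k * y) (l / sqrt (1 + l\<^sup>2)) b)"
        by (simp flip: ennreal_mult)
    qed
    also have "\<dots> = ennreal ?v * ennreal ((l / sqrt (1 + l\<^sup>2))\<^sup>2 + (?k * y - c)\<^sup>2)"
      using that by (subst nn_integral_cmult)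
        (auto simp: nn_integral_normal_second_moment add_pos_nonneg)
    also have "(l / sqrt (1 + l\<^sup>2))\<^sup>2 = ?k"
      by (simp add: power_divide)
    finally show ?thesis by (simp only: ennreal_mult normal_density_nonneg add_nonneg_nonneg zero_le_power2 divide_nonneg_nonneg zero_le_one)
  qed
  then show ?thesis
    by (subst nn_integral_glt_prior1) (auto intro!: nn_integral_cong_AE eventually_mono[OF AE_gpd_pos])
qed

lemma nn_integral_glt_prior1_density:
  "(\<integral>\<^sup>+b. ennreal (normal_density b 1 y) \<partial>glt_prior1 \<tau> \<xi>)
    = (\<integral>\<^sup>+l. ennreal (normal_density 0 (sqrt (1 + l\<^sup>2)) y) \<partial>gpd \<tau> \<xi>)"
proof -
  have "(\<integral>\<^sup>+b. ennreal (normal_density 0 l b) * ennreal (normal_density b 1 y) \<partial>lborel)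
      = ennreal (normal_density 0 (sqrt (1 + l\<^sup>2)) y)" if "0 < l" for l
  proof -
    let ?k = "l\<^sup>2 / (1 + l\<^sup>2)" and ?v = "normal_density 0 (sqrt (1 + l\<^sup>2)) y"
    have "0 < l / sqrt (1 + l\<^sup>2)"
      using that by (simp add: add_pos_nonneg)
    then interpret prob_space "density lborel (\<lambda>x. ennreal (normal_density (?k * y) (l / sqrt (1 + l\<^sup>2)) x))"
      by (rule prob_space_normal_density)
    have "(\<integral>\<^sup>+b. ennreal (normal_density 0 l b) * ennreal (normal_density b 1 y) \<partial>lborel)
        = (\<integral>\<^sup>+b. ennreal ?v * ennreal (normal_density (?k * y) (l / sqrt (1 + l\<^sup>2)) b) \<partial>lborel)"
      using normal_density_conjugate[OF that]
      by (intro nn_integral_cong) (simp flip: ennreal_mult add: mult.commute)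
    also have "\<dots> = ennreal ?v"
      using emeasure_space_1 by (subst nn_integral_cmult) (auto simp: emeasure_density)
    finally show ?thesis .
  qed
  then show ?thesis
    by (subst nn_integral_glt_prior1) (auto intro!: nn_integral_cong_AE eventually_mono[OF AE_gpd_pos])
qed

section \<open>The generalized Pareto law: fractional moments and lower bounds for the marginal
  density\<close>

lemma measurable_gpd_density [measurable]: "gpd_density \<tau> \<xi> \<in> borel_measurable borel"
  unfolding gpd_density_def[abs_def] by measurable

lemma gpd_density_nonneg: "0 < \<tau> \<Longrightarrow> 0 \<le> gpd_density \<tau> \<xi> l"
  by (simp add: gpd_density_def)

text \<open>Discards all scales outside one interval. The left end is open because
  \<open>gpd_density\<close> vanishes at 0 and the case \<open>a = 0\<close> is needed.\<close>

lemma nn_integral_gpd_ge: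
  assumes [measurable]: "f \<in> borel_measurable borel"
    and "0 < \<tau>" "a \<le> b" "0 \<le> k"
    and le: "\<And>l. a < l \<Longrightarrow> l \<le> b \<Longrightarrow> k \<le> f l * gpd_density \<tau> \<xi> l"
    and f: "\<And>l. 0 \<le> f l"
  shows "ennreal (k * (b - a)) \<le> (\<integral>\<^sup>+l. ennreal (f l) \<partial>gpd \<tau> \<xi>)"
proof -
  have "ennreal (k * (b - a)) = (\<integral>\<^sup>+l. ennreal k * indicator {a<..b} l \<partial>lborel)"
    using assms by (subst nn_integral_cmult_indicator) (auto simp flip: ennreal_mult)
  also have "\<dots> \<le> (\<integral>\<^sup>+l. ennreal (gpd_density \<tau> \<xi> l) * ennreal (f l) \<partial>lborel)"
  proof (rule nn_integral_mono)
    fix l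
    show "ennreal k * indicator {a<..b} l \<le> ennreal (gpd_density \<tau> \<xi> l) * ennreal (f l)"
      using le[of l] gpd_density_nonneg[OF \<open>0 < \<tau>\<close>, of \<xi> l] f[of l]
      by (auto simp: indicator_def mult.commute simp flip: ennreal_mult intro!: ennreal_leI)
  qed
  finally show ?thesis
    by (simp add: gpd_def nn_integral_density)
qed

lemma gpd_density_ge:
  assumes "0 < \<tau>" "0 < \<xi>" "0 < l" "l \<le> u"
  shows "1 / \<tau> * (1 + \<xi> * u / \<tau>) powr (- (1 / \<xi> + 1)) \<le> gpd_density \<tau> \<xi> l"
proof -
  have e: "- (1 / \<xi> + 1) \<le> 0"
    using divide_pos_pos[OF zero_less_one \<open>0 < \<xi>\<close>] by linarith
  have "(1 + \<xi> * u / \<tau>) powr (- (1 / \<xi> + 1)) \<le> (1 + \<xi> * l / \<tau>) powr (- (1 / \<xi> + 1))"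
    using assms by (intro powr_mono2' e) (auto intro!: add_pos_nonneg divide_right_mono)
  then show ?thesis
    using assms by (simp add: gpd_density_def divide_right_mono)
qed

text \<open>
  After the bound \<open>l / \<tau> \<le> (1 + \<xi> l / \<tau>) / \<xi>\<close> the integrand is, up to a constant, again
  a generalized Pareto density, of shape \<open>\<xi> / (1 - p \<xi>)\<close>.
\<close>

lemma nn_integral_gpd_powr_le:
  assumes "0 < \<tau>" "0 < \<xi>" "0 \<le> p" "p < 1 / \<xi>"
  shows "(\<integral>\<^sup>+l. ennreal (l powr p) \<partial>gpd \<tau> \<xi>) \<le> ennreal (\<xi> powr (- p) / (1 - p * \<xi>) * \<tau> powr p)"
proof -
  define d where "d = 1 - p * \<xi>"
  define \<xi>' where "\<xi>' = \<xi> / d"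
  define \<tau>' where "\<tau>' = \<tau> / d"
  have d: "0 < d" using assms by (simp add: d_def field_simps)
  have pos: "0 < \<xi>'" "0 < \<tau>'" using assms d by (auto simp: \<xi>'_def \<tau>'_def)
  interpret prob_space "gpd \<tau>' \<xi>'" using pos by (intro prob_space_gpd)
  define C where "C = \<xi> powr (- p) / d * \<tau> powr p"
  have "gpd_density \<tau> \<xi> l * l powr p \<le> C * gpd_density \<tau>' \<xi>' l" for l
  proof (cases "0 < l")
    case True
    define w where "w = 1 + \<xi> * l / \<tau>"
    have w: "0 < w" using assms True by (simp add: w_def add_pos_nonneg)
    have "l \<le> \<tau> / \<xi> * w"
      using assms by (simp add: w_def field_simps)
    then have "l powr p \<le> (\<tau> / \<xi> * w) powr p"
      using True assms by (intro powr_mono2) auto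
    also have "\<dots> = \<tau> powr p * \<xi> powr (- p) * w powr p"
      using assms w by (simp add: powr_mult powr_divide powr_minus_divide)
    finally have "1 / \<tau> * w powr (- (1 / \<xi> + 1)) * l powr p
        \<le> 1 / \<tau> * w powr (- (1 / \<xi> + 1)) * (\<tau> powr p * \<xi> powr (- p) * w powr p)"
      using assms by (intro mult_left_mono) auto
    also have "\<dots> = 1 / \<tau> * (\<tau> powr p * \<xi> powr (- p)) * w powr (- (1 / \<xi> + 1) + p)"
      by (simp only: powr_add) simp
    also have "- (1 / \<xi> + 1) + p = - (1 / \<xi>' + 1)"
      using assms d by (simp add: \<xi>'_def d_def field_simps)
    also have "1 / \<tau> * (\<tau> powr p * \<xi> powr (- p)) = C * (1 / \<tau>')"
      using d by (simp add: C_def \<tau>'_def)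
    also have "w = 1 + \<xi>' * l / \<tau>'"
      using d by (simp add: w_def \<xi>'_def \<tau>'_def)
    finally show ?thesis
      using True d by (simp add: gpd_density_def w_def \<xi>'_def \<tau>'_def mult_ac)
  qed (simp add: gpd_density_def)
  then have "ennreal (gpd_density \<tau> \<xi> l) * ennreal (l powr p) \<le> ennreal C * ennreal (gpd_density \<tau>' \<xi>' l)" for l
    using assms pos d by (simp add: gpd_density_nonneg C_def ennreal_leI flip: ennreal_mult)
  then have "(\<integral>\<^sup>+l. ennreal (l powr p) \<partial>gpd \<tau> \<xi>)
      \<le> (\<integral>\<^sup>+l. ennreal C * ennreal (gpd_density \<tau>' \<xi>' l) \<partial>lborel)"
    unfolding gpd_def by (subst nn_integral_density) (auto intro!: nn_integral_mono)
  also have "\<dots> = ennreal C"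
    using emeasure_space_1
    by (subst nn_integral_cmult) (auto simp: gpd_def emeasure_density)
  finally show ?thesis by (simp add: C_def d_def)
qed

text \<open>Only scales in \<open>(\<bar>y\<bar>, 2 \<bar>y\<bar>]\<close> are kept. There the
  normal density is at least of order \<open>1 / \<bar>y\<bar>\<close> and the Pareto density at
  least of order \<open>\<tau> powr (1 / \<xi>) / \<bar>y\<bar> ^ 3\<close>; the interval length
  \<open>\<bar>y\<bar>\<close> cancels the first factor.\<close>

lemma gpd_marginal_ge_tail:
  assumes "0 < \<tau>" "\<tau> \<le> 1" "1 / 2 < \<xi>" "1 \<le> \<bar>y\<bar>"
  shows "ennreal (exp (- 1 / 2) / (3 * sqrt (2 * pi)) * (1 + 2 * \<xi>) powr (- (1 / \<xi> + 1))
      * (\<tau> powr (1 / \<xi>) / \<bar>y\<bar> ^ 3))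
    \<le> (\<integral>\<^sup>+l. ennreal (normal_density 0 (sqrt (1 + l\<^sup>2)) y) \<partial>gpd \<tau> \<xi>)"
proof -
  define Y where "Y = \<bar>y\<bar>"
  define e where "e = 1 / \<xi> + 1"
  define k where "k = exp (- 1 / 2) / (3 * sqrt (2 * pi) * Y) * ((1 + 2 * \<xi>) powr (- e) * (\<tau> powr (1 / \<xi>) / Y ^ 3))"
  have Y: "1 \<le> Y" using assms by (simp add: Y_def)
  have \<xi>: "0 < \<xi>" using assms by simp
  have e: "0 < e" "e \<le> 3" using assms by (auto simp: e_def add_pos_nonneg field_simps)
  have k0: "0 \<le> k" using \<xi> Y by (simp add: k_def)
  have dens: "(1 + 2 * \<xi>) powr (- e) * (\<tau> powr (1 / \<xi>) / Y ^ 3) \<le> gpd_density \<tau> \<xi> l"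
    if l: "Y < l" "l \<le> Y + Y" for l
  proof -
    \<comment> \<open>Since \<open>Y / \<tau>\<close> is at least 1, it absorbs the additive 1 in
      the Pareto density.\<close>
    have "1 \<le> Y / \<tau>" using Y assms by (simp add: field_simps)
    then have "1 + \<xi> * (Y + Y) / \<tau> \<le> (1 + 2 * \<xi>) * (Y / \<tau>)"
      by (simp add: algebra_simps)
    then have "((1 + 2 * \<xi>) * (Y / \<tau>)) powr (- e) \<le> (1 + \<xi> * (Y + Y) / \<tau>) powr (- e)"
      using \<xi> Y assms e by (intro powr_mono2') (auto intro!: add_pos_nonneg)
    moreover have "((1 + 2 * \<xi>) * (Y / \<tau>)) powr (- e) = (1 + 2 * \<xi>) powr (- e) * (Y powr (- e) * \<tau> powr e)"
      using \<xi> Y assms by (simp add: powr_mult powr_divide powr_minus_divide)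
    \<comment> \<open>The exponent \<open>e = 1 / \<xi> + 1\<close> is at most 3 because
      \<open>1 / \<xi> < 2\<close>. The cube is the power of \<open>\<bar>y\<bar>\<close> that the
      upper bound for signals produces.\<close>
    moreover have "1 / Y ^ 3 \<le> Y powr (- e)"
    proof -
      have "Y powr e \<le> Y powr 3" using Y e by (intro powr_mono) auto
      then show ?thesis
        using Y by (simp add: powr_minus_divide powr_numeral frac_le)
    qed
    then have "(1 + 2 * \<xi>) powr (- e) * (1 / Y ^ 3 * \<tau> powr e)
        \<le> (1 + 2 * \<xi>) powr (- e) * (Y powr (- e) * \<tau> powr e)"
      by (intro mult_left_mono mult_right_mono) auto
    ultimately have "1 / \<tau> * ((1 + 2 * \<xi>) powr (- e) * (1 / Y ^ 3 * \<tau> powr e))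
        \<le> 1 / \<tau> * (1 + \<xi> * (Y + Y) / \<tau>) powr (- e)"
      using assms by (intro mult_left_mono) auto
    moreover have te: "\<tau> powr e = \<tau> * \<tau> powr (1 / \<xi>)"
      using assms by (simp add: e_def powr_add)
    have "1 / \<tau> * ((1 + 2 * \<xi>) powr (- e) * (1 / Y ^ 3 * \<tau> powr e))
        = (1 + 2 * \<xi>) powr (- e) * (\<tau> powr (1 / \<xi>) / Y ^ 3)"
      unfolding te using assms by simp
    ultimately show ?thesis
      using gpd_density_ge[of \<tau> \<xi> l "Y + Y"] assms \<xi> l Y by (simp add: e_def)
  qed
  have norm: "exp (- 1 / 2) / (3 * sqrt (2 * pi) * Y) \<le> normal_density 0 (sqrt (1 + l\<^sup>2)) y"
    if l: "Y < l" "l \<le> Y + Y" for l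
  proof -
    have s: "0 < 1 + l\<^sup>2" by (simp add: add_pos_nonneg)
    have "y\<^sup>2 \<le> l\<^sup>2" using l by (simp add: Y_def abs_le_square_iff[symmetric])
    then have "exp (- 1 / 2) \<le> exp (- (y\<^sup>2 / (2 * (1 + l\<^sup>2))))"
      using s by (simp add: field_simps)
    moreover have "1 + l\<^sup>2 \<le> (3 * Y)\<^sup>2"
    proof -
      have "l\<^sup>2 \<le> (Y + Y)\<^sup>2" using l Y by (intro power_mono) auto
      moreover have "1 \<le> Y\<^sup>2" using Y by simp
      ultimately show ?thesis by (simp add: power2_eq_square algebra_simps)
    qed
    then have "sqrt (1 + l\<^sup>2) \<le> 3 * Y" using Y by (intro real_le_lsqrt) auto
    then have "sqrt (2 * pi) * sqrt (1 + l\<^sup>2) \<le> sqrt (2 * pi) * (3 * Y)"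
      by (intro mult_left_mono) auto
    then have "sqrt (2 * pi * (1 + l\<^sup>2)) \<le> 3 * sqrt (2 * pi) * Y"
      by (simp add: real_sqrt_mult)
    ultimately have "exp (- 1 / 2) / (3 * sqrt (2 * pi) * Y)
        \<le> exp (- (y\<^sup>2 / (2 * (1 + l\<^sup>2)))) / sqrt (2 * pi * (1 + l\<^sup>2))"
      using s by (intro frac_le) auto
    then show ?thesis
      using s by (simp add: normal_density_def)
  qed
  have "ennreal (k * (Y + Y - Y)) \<le> (\<integral>\<^sup>+l. ennreal (normal_density 0 (sqrt (1 + l\<^sup>2)) y) \<partial>gpd \<tau> \<xi>)"
    using assms Y k0 \<xi> unfolding k_def
    by (intro nn_integral_gpd_ge mult_mono norm dens) auto
  also have "k * (Y + Y - Y) = exp (- 1 / 2) / (3 * sqrt (2 * pi)) * (1 + 2 * \<xi>) powr (- e)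
      * (\<tau> powr (1 / \<xi>) / Y ^ 3)"
    using Y by (simp add: k_def)
  finally show ?thesis by (simp add: Y_def e_def)
qed

text \<open>Scales in \<open>(0, \<tau>]\<close> have Pareto density at least a constant over
  \<open>\<tau>\<close>, hence prior mass bounded below independently of \<open>\<tau>\<close>. For
  them \<open>1 + l\<^sup>2\<close> lies between 1 and 2, which costs only the factor
  \<open>sqrt 2\<close>.\<close>

lemma gpd_marginal_ge_normal:
  assumes "0 < \<tau>" "\<tau> \<le> 1" "0 < \<xi>"
  shows "ennreal ((1 + \<xi>) powr (- (1 / \<xi> + 1)) / sqrt 2 * normal_density 0 1 y)
    \<le> (\<integral>\<^sup>+l. ennreal (normal_density 0 (sqrt (1 + l\<^sup>2)) y) \<partial>gpd \<tau> \<xi>)"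
proof -
  define k where "k = (normal_density 0 1 y / sqrt 2) * (1 / \<tau> * (1 + \<xi>) powr (- (1 / \<xi> + 1)))"
  have norm: "normal_density 0 1 y / sqrt 2 \<le> normal_density 0 (sqrt (1 + l\<^sup>2)) y"
    if l: "0 < l" "l \<le> \<tau>" for l
  proof -
    have s: "1 \<le> 1 + l\<^sup>2" "1 + l\<^sup>2 \<le> 2"
      using l assms by (auto intro!: power_le_one)
    have "y\<^sup>2 / (2 * (1 + l\<^sup>2)) \<le> y\<^sup>2 / 2"
      using s by (intro divide_left_mono) (auto simp: add_pos_nonneg)
    then have "exp (- (y\<^sup>2 / 2)) \<le> exp (- (y\<^sup>2 / (2 * (1 + l\<^sup>2))))"
      by simp
    moreover have "sqrt (2 * pi * (1 + l\<^sup>2)) \<le> sqrt (2 * pi) * sqrt 2"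
      using s by (simp add: real_sqrt_mult)
    ultimately have "exp (- (y\<^sup>2 / 2)) / (sqrt (2 * pi) * sqrt 2)
        \<le> exp (- (y\<^sup>2 / (2 * (1 + l\<^sup>2)))) / sqrt (2 * pi * (1 + l\<^sup>2))"
      using s by (intro frac_le) (auto simp: add_pos_nonneg)
    then show ?thesis
      using s by (simp add: normal_density_def)
  qed
  have "ennreal (k * (\<tau> - 0)) \<le> (\<integral>\<^sup>+l. ennreal (normal_density 0 (sqrt (1 + l\<^sup>2)) y) \<partial>gpd \<tau> \<xi>)"
    using assms gpd_density_ge[of \<tau> \<xi> _ \<tau>] unfolding k_def
    by (intro nn_integral_gpd_ge mult_mono norm) auto
  then show ?thesis using assms by (simp add: k_def mult.commute)
qed

section \<open>Marginal density and posterior risk of one coordinate\<close>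

definition glt_marginal :: "real \<Rightarrow> real \<Rightarrow> real \<Rightarrow> ennreal" where
  "glt_marginal \<tau> \<xi> y = (\<integral>\<^sup>+b. ennreal (normal_density b 1 y) \<partial>glt_prior1 \<tau> \<xi>)"

text \<open>The posterior second moment about \<open>c\<close> given the observation
  \<open>y\<close>, by Bayes' formula. With values in \<open>ennreal\<close> it can be bounded
  without prior integrability arguments; the denominator is shown below to be positive and at most 1
  in the relevant range of parameters.\<close>

definition glt_risk :: "real \<Rightarrow> real \<Rightarrow> real \<Rightarrow> real \<Rightarrow> ennreal" where
  "glt_risk \<tau> \<xi> c y =
    (\<integral>\<^sup>+b. ennreal ((b - c)\<^sup>2 * normal_density b 1 y) \<partial>glt_prior1 \<tau> \<xi>) / glt_marginal \<tau> \<xi> y"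

lemma glt_marginal_eq:
  "glt_marginal \<tau> \<xi> y = (\<integral>\<^sup>+l. ennreal (normal_density 0 (sqrt (1 + l\<^sup>2)) y) \<partial>gpd \<tau> \<xi>)"
  unfolding glt_marginal_def by (rule nn_integral_glt_prior1_density)

lemma glt_risk_eq:
  "glt_risk \<tau> \<xi> c y = (\<integral>\<^sup>+l. ennreal (normal_density 0 (sqrt (1 + l\<^sup>2)) y *
        (l\<^sup>2 / (1 + l\<^sup>2) + (l\<^sup>2 / (1 + l\<^sup>2) * y - c)\<^sup>2)) \<partial>gpd \<tau> \<xi>) / glt_marginal \<tau> \<xi> y"
  unfolding glt_risk_def nn_integral_glt_prior1_sq ..

lemma glt_marginal_pos:
  assumes "0 < \<tau>" "\<tau> \<le> 1" "0 < \<xi>"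
  shows "0 < glt_marginal \<tau> \<xi> y"
proof -
  have "0 < ennreal ((1 + \<xi>) powr (- (1 / \<xi> + 1)) / sqrt 2 * normal_density 0 1 y)"
    using assms by (simp add: normal_density_pos)
  also have "\<dots> \<le> glt_marginal \<tau> \<xi> y"
    unfolding glt_marginal_eq using assms by (rule gpd_marginal_ge_normal)
  finally show ?thesis .
qed

lemma glt_marginal_le_1:
  assumes "0 < \<tau>" "0 < \<xi>"
  shows "glt_marginal \<tau> \<xi> y \<le> 1"
proof -
  interpret prob_space "glt_prior1 \<tau> \<xi>" using assms by (rule prob_space_glt_prior1)
  \<comment> \<open>A single normal density is a likelihood with one coordinate, so
    \<open>likelihood_le_1\<close> bounds it by 1.\<close>
  have "glt_marginal \<tau> \<xi> y \<le> (\<integral>\<^sup>+b. 1 \<partial>glt_prior1 \<tau> \<xi>)"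
    unfolding glt_marginal_def
    using likelihood_le_1[of "Suc 0" "\<lambda>_. y"] by (intro nn_integral_mono) (auto simp: likelihood_def)
  also have "\<dots> = 1" using emeasure_space_1 by simp
  finally show ?thesis .
qed

section \<open>Risk at signals\<close>

lemma sq_over_one_plus_sq_le_1: "l\<^sup>2 / (1 + l\<^sup>2) \<le> (1::real)"
  by (subst pos_divide_le_eq) (auto simp: add_pos_nonneg)

text \<open>In terms of the standardised observation \<open>z\<close> the left-hand side is at most
  \<open>z ^ 5 * exp (- (z\<^sup>2 / 2)) / \<bar>y\<bar> ^ 3\<close>. Half of the exponent pays for
  \<open>z ^ 5\<close>, the other half for the power of \<open>\<tau>\<close>. It is applied with
  \<open>a = 1 / \<xi>\<close>.\<close>

lemma normal_density_mult_sq_le: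
  fixes y l \<tau> :: real
  assumes "0 < \<tau>" "\<tau> \<le> 1" "a \<le> 2" "1 \<le> \<bar>y\<bar>"
    and large: "8 * (1 + ln (1 / \<tau>)) * (1 + l\<^sup>2) < y\<^sup>2"
  shows "normal_density 0 (sqrt (1 + l\<^sup>2)) y * (y\<^sup>2 / (1 + l\<^sup>2)\<^sup>2) \<le> 1728 * (\<tau> powr a / \<bar>y\<bar> ^ 3)"
proof -
  define s where "s = 1 + l\<^sup>2"
  define z where "z = \<bar>y\<bar> / sqrt s"
  have s: "1 \<le> s" by (simp add: s_def)
  have y: "0 < \<bar>y\<bar>" using assms by linarith
  have ln: "0 \<le> ln (1 / \<tau>)" using assms by simp
  have z2: "z\<^sup>2 = y\<^sup>2 / s" using s by (simp add: z_def power_divide)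
  have z2_ge: "8 * (1 + ln (1 / \<tau>)) \<le> z\<^sup>2"
    using large s unfolding z2 s_def[symmetric] by (subst pos_le_divide_eq) auto
  have "1 * 1 \<le> 8 * (1 + ln (1 / \<tau>))" using ln by (intro mult_mono) auto
  then have "1 * 1 \<le> z\<^sup>2" using z2_ge by (rule order_trans)
  then have "1 \<le> z\<^sup>2" by simp
  moreover have "0 \<le> z" using s by (simp add: z_def)
  ultimately have z1: "1 \<le> z" using power2_le_imp_le[of 1 z] by simp
  have "z ^ 5 * exp (- (z\<^sup>2 / 2)) \<le> 1728 * \<tau> powr a"
  proof -
    \<comment> \<open>Cubing \<open>x \<le> exp x\<close> at \<open>x = z\<^sup>2 / 12\<close>
      bounds \<open>z ^ 6\<close> by \<open>12 ^ 3 = 1728\<close> times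
      \<open>exp (z\<^sup>2 / 4)\<close>.\<close>
    have "z\<^sup>2 / 12 \<le> exp (z\<^sup>2 / 12)"
      using exp_ge_add_one_self[of "z\<^sup>2 / 12"] by linarith
    then have "(z\<^sup>2 / 12) ^ 3 \<le> exp (z\<^sup>2 / 12) ^ 3"
      by (intro power_mono) auto
    moreover have "exp (z\<^sup>2 / 12) ^ 3 = exp (z\<^sup>2 / 4)"
      by (simp flip: exp_of_nat_mult)
    moreover have "(z\<^sup>2 / 12) ^ 3 = z ^ 6 / 1728"
      by (simp add: power_divide flip: power_mult)
    moreover have "z ^ 5 \<le> z ^ 6" using z1 by (intro power_increasing) auto
    ultimately have "z ^ 5 \<le> 1728 * exp (z\<^sup>2 / 4)" by simp
    then have "z ^ 5 * exp (- (z\<^sup>2 / 2)) \<le> 1728 * exp (z\<^sup>2 / 4) * exp (- (z\<^sup>2 / 2))"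
      by (intro mult_right_mono) auto
    also have "\<dots> = 1728 * exp (- (z\<^sup>2 / 4))"
      by (simp flip: exp_add)
    \<comment> \<open>The factor 8 in the threshold is spent here: a quarter of
      \<open>z\<^sup>2\<close> is at least \<open>2 * ln (1 / \<tau>)\<close>. Then
      \<open>a \<le> 2\<close> and \<open>ln \<tau> \<le> 0\<close> give the power
      \<open>a\<close>.\<close>
    also have "exp (- (z\<^sup>2 / 4)) \<le> exp (2 * ln \<tau>)"
      using z2_ge assms by (simp add: ln_div)
    also have "exp (2 * ln \<tau>) \<le> exp (a * ln \<tau>)"
      using assms by (simp add: mult_right_mono_neg)
    also have "\<dots> = \<tau> powr a" using assms by (simp add: powr_def)
    finally show ?thesis by simp
  qed
  then have "z ^ 5 * exp (- (z\<^sup>2 / 2)) / \<bar>y\<bar> ^ 3 \<le> 1728 * \<tau> powr a / \<bar>y\<bar> ^ 3"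
    by (rule divide_right_mono) simp
  moreover have "normal_density 0 (sqrt s) y * (y\<^sup>2 / s\<^sup>2) \<le> z ^ 5 * exp (- (z\<^sup>2 / 2)) / \<bar>y\<bar> ^ 3"
  proof -
    have "sqrt s * s\<^sup>2 = sqrt s ^ 5"
    proof -
      have "w ^ 5 = w * (w\<^sup>2)\<^sup>2" for w :: real by (simp add: power_numeral_reduce)
      moreover have "(sqrt s)\<^sup>2 = s" using s by simp
      ultimately show ?thesis by metis
    qed
    moreover have "y\<^sup>2 = \<bar>y\<bar> ^ 5 / \<bar>y\<bar> ^ 3"
      using y by (simp add: field_simps power_numeral_reduce)
    ultimately have zz: "z ^ 5 / \<bar>y\<bar> ^ 3 = y\<^sup>2 / (sqrt s * s\<^sup>2)"
      by (simp add: z_def power_divide)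
    have "z ^ 5 * exp (- (z\<^sup>2 / 2)) / \<bar>y\<bar> ^ 3 = z ^ 5 / \<bar>y\<bar> ^ 3 * exp (- (z\<^sup>2 / 2))"
      by simp
    also have "\<dots> = exp (- (y\<^sup>2 / s / 2)) / sqrt s * (y\<^sup>2 / s\<^sup>2)"
      unfolding zz z2 by simp
    finally have "z ^ 5 * exp (- (z\<^sup>2 / 2)) / \<bar>y\<bar> ^ 3
        = exp (- (y\<^sup>2 / s / 2)) / sqrt s * (y\<^sup>2 / s\<^sup>2)" .
    moreover have "exp (- (y\<^sup>2 / s / 2)) / (sqrt (2 * pi) * sqrt s) \<le> exp (- (y\<^sup>2 / s / 2)) / sqrt s"
    proof (rule divide_left_mono)
      have "1 \<le> sqrt (2 * pi)" using pi_ge_two by (simp add: real_le_rsqrt)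
      then show "sqrt s \<le> sqrt (2 * pi) * sqrt s" using s by (simp add: mult_le_cancel_right1)
    qed (use s in auto)
    then have "normal_density 0 (sqrt s) y \<le> exp (- (y\<^sup>2 / s / 2)) / sqrt s"
      using s by (simp add: normal_density_def real_sqrt_mult mult.commute)
    then have "normal_density 0 (sqrt s) y * (y\<^sup>2 / s\<^sup>2) \<le> exp (- (y\<^sup>2 / s / 2)) / sqrt s * (y\<^sup>2 / s\<^sup>2)"
      by (intro mult_right_mono) auto
    ultimately show ?thesis by simp
  qed
  ultimately show ?thesis
    unfolding s_def[symmetric] times_divide_eq_right by linarith
qed

text \<open>About the observation itself the bias is \<open>- y / (1 + l\<^sup>2)\<close>. It is of
  order \<open>sqrt L\<close> unless \<open>y\<close> is far out for the scale \<open>l\<close>, and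
  the contribution of such scales is controlled by the lower tail bound on the marginal density.
  Hence the bound is uniform in \<open>y\<close>.\<close>

lemma glt_risk_self_le:
  assumes "1 / 2 < \<xi>"
  obtains C where "0 < C"
    "\<And>\<tau> y. 0 < \<tau> \<Longrightarrow> \<tau> \<le> 1 \<Longrightarrow> glt_risk \<tau> \<xi> y y \<le> ennreal (C * (1 + ln (1 / \<tau>)))"
proof
  define c where "c = exp (- 1 / 2) / (3 * sqrt (2 * pi)) * (1 + 2 * \<xi>) powr (- (1 / \<xi> + 1))"
  have c: "0 < c" using assms by (simp add: c_def)
  have \<xi>: "0 < \<xi>" using assms by simp
  \<comment> \<open>Of the 9, the variance takes 1 and the squared bias 8 at scales with
    \<open>y\<^sup>2 \<le> 8 * L * (1 + l\<^sup>2)\<close>; the other scales give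
    \<open>1728 / c\<close>.\<close>
  show "0 < 9 + 1728 / c" using c by (simp add: add_pos_nonneg)
  fix \<tau> y :: real
  assume \<tau>: "0 < \<tau>" "\<tau> \<le> 1"
  define L where "L = 1 + ln (1 / \<tau>)"
  \<comment> \<open>The value 0 is harmless: for \<open>\<bar>y\<bar> < 1\<close> no scale lies
    beyond the threshold, since \<open>8 * L * (1 + l\<^sup>2)\<close> is at least 1.\<close>
  define D where "D = (if 1 \<le> \<bar>y\<bar> then \<tau> powr (1 / \<xi>) / \<bar>y\<bar> ^ 3 else 0)"
  have L: "1 \<le> L" using \<tau> by (simp add: L_def)
  have D0: "0 \<le> D" using \<tau> by (auto simp: D_def)
  have D: "ennreal (c * D) \<le> glt_marginal \<tau> \<xi> y"
  proof (cases "1 \<le> \<bar>y\<bar>")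
    case True
    then show ?thesis
      using gpd_marginal_ge_tail[OF \<tau> assms True] by (simp only: D_def c_def glt_marginal_eq if_True)
  qed (simp add: D_def)
  let ?v = "\<lambda>l. normal_density 0 (sqrt (1 + l\<^sup>2)) y"
  have pt: "?v l * (l\<^sup>2 / (1 + l\<^sup>2) + (l\<^sup>2 / (1 + l\<^sup>2) * y - y)\<^sup>2) \<le> 9 * L * ?v l + 1728 * D" for l
  proof -
    have s: "0 < 1 + l\<^sup>2" "1 \<le> 1 + l\<^sup>2" by (auto simp: add_pos_nonneg)
    have "(1 + l\<^sup>2) / (1 + l\<^sup>2) = 1" using s(1) by (intro divide_self) linarith
    then have ab: "l\<^sup>2 / (1 + l\<^sup>2) = 1 - 1 / (1 + l\<^sup>2)"
      unfolding add_divide_distrib by linarith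
    have "l\<^sup>2 / (1 + l\<^sup>2) * y - y = - (1 / (1 + l\<^sup>2) * y)"
      unfolding ab left_diff_distrib by linarith
    then have eq: "(l\<^sup>2 / (1 + l\<^sup>2) * y - y)\<^sup>2 = y\<^sup>2 / (1 + l\<^sup>2)\<^sup>2"
      by (simp add: power_divide)
    have v: "0 \<le> ?v l" by simp
    have "l\<^sup>2 / (1 + l\<^sup>2) \<le> L" using sq_over_one_plus_sq_le_1 L by (rule order_trans)
    then have 1: "?v l * (l\<^sup>2 / (1 + l\<^sup>2)) \<le> ?v l * L" by (intro mult_left_mono) auto
    have 2: "?v l * (y\<^sup>2 / (1 + l\<^sup>2)\<^sup>2) \<le> 8 * L * ?v l + 1728 * D"
    proof (cases "y\<^sup>2 \<le> 8 * L * (1 + l\<^sup>2)")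
      case True
      then have "y\<^sup>2 / (1 + l\<^sup>2)\<^sup>2 \<le> 8 * L * (1 + l\<^sup>2) / (1 + l\<^sup>2)\<^sup>2"
        by (intro divide_right_mono) auto
      also have "\<dots> = 8 * L / (1 + l\<^sup>2)" using s by (simp add: power2_eq_square)
      also have "\<dots> \<le> 8 * L / 1" using s L by (intro divide_left_mono) (auto simp: add_pos_nonneg)
      finally have "?v l * (y\<^sup>2 / (1 + l\<^sup>2)\<^sup>2) \<le> ?v l * (8 * L)"
        by (intro mult_left_mono) auto
      then show ?thesis using D0 by (simp add: mult.commute)
    next
      case False
      have "1 * 1 \<le> 8 * L * (1 + l\<^sup>2)" using L s by (intro mult_mono) auto
      also have "\<dots> \<le> y\<^sup>2" using False by (simp only: not_le less_imp_le)
      finally have "1 \<le> \<bar>y\<bar>" using abs_le_square_iff[of 1 y] by simp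
      then have "?v l * (y\<^sup>2 / (1 + l\<^sup>2)\<^sup>2) \<le> 1728 * D"
        using normal_density_mult_sq_le[OF \<tau>, of "1 / \<xi>" y l] False assms
        by (simp add: D_def L_def field_simps)
      moreover have "0 \<le> 8 * L * ?v l" using L by simp
      ultimately show ?thesis by linarith
    qed
    show ?thesis unfolding eq distrib_left using 1 2 by (simp add: algebra_simps)
  qed
  have "(\<integral>\<^sup>+l. ennreal (?v l * (l\<^sup>2 / (1 + l\<^sup>2) + (l\<^sup>2 / (1 + l\<^sup>2) * y - y)\<^sup>2)) \<partial>gpd \<tau> \<xi>)
      \<le> (\<integral>\<^sup>+l. ennreal (9 * L) * ennreal (?v l) + ennreal (1728 * D) \<partial>gpd \<tau> \<xi>)"
    using L D0 pt by (intro nn_integral_mono) (simp add: ennreal_leI flip: ennreal_mult ennreal_plus)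
  also have "\<dots> = ennreal (9 * L) * glt_marginal \<tau> \<xi> y + ennreal (1728 * D)"
  proof -
    interpret prob_space "gpd \<tau> \<xi>" using \<tau> \<xi> by (intro prob_space_gpd)
    show ?thesis
      using emeasure_space_1
      by (subst nn_integral_add) (auto simp: nn_integral_cmult glt_marginal_eq)
  qed
  \<comment> \<open>The remainder no longer depends on \<open>l\<close>; written as a multiple of
    \<open>c * D\<close> it is dominated by the marginal density, which then cancels in the
    quotient.\<close>
  also have "ennreal (1728 * D) = ennreal (1728 / c) * ennreal (c * D)"
    using c D0 by (simp flip: ennreal_mult)
  also have "\<dots> \<le> ennreal (1728 / c * L) * glt_marginal \<tau> \<xi> y"
    using c L D by (intro mult_mono ennreal_leI) (auto simp: divide_right_mono)
  finally have "(\<integral>\<^sup>+l. ennreal (?v l * (l\<^sup>2 / (1 + l\<^sup>2) + (l\<^sup>2 / (1 + l\<^sup>2) * y - y)\<^sup>2)) \<partial>gpd \<tau> \<xi>)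
      \<le> ennreal (9 * L) * glt_marginal \<tau> \<xi> y + ennreal (1728 / c * L) * glt_marginal \<tau> \<xi> y"
    by simp
  also have "\<dots> = glt_marginal \<tau> \<xi> y * ennreal ((9 + 1728 / c) * L)"
  proof -
    have "ennreal ((9 + 1728 / c) * L) = ennreal (9 * L) + ennreal (1728 / c * L)"
      unfolding distrib_right using c L by (intro ennreal_plus) auto
    then show ?thesis by (simp only: distrib_left mult.commute)
  qed
  finally show "glt_risk \<tau> \<xi> y y \<le> ennreal ((9 + 1728 / c) * (1 + ln (1 / \<tau>)))"
    unfolding glt_risk_eq L_def using glt_marginal_pos[OF \<tau> \<xi>] by (intro divide_le_posI_ennreal)
qed

text \<open>Moves the centre from the observation to the true coefficient, at the price of a factor
  2 and the squared observation error.\<close>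

lemma glt_risk_le_self:
  assumes "0 < \<tau>" "\<tau> \<le> 1" "0 < \<xi>"
  shows "glt_risk \<tau> \<xi> c y \<le> 2 * glt_risk \<tau> \<xi> y y + ennreal (2 * (y - c)\<^sup>2)"
proof -
  let ?N = "\<lambda>c. \<integral>\<^sup>+b. ennreal ((b - c)\<^sup>2 * normal_density b 1 y) \<partial>glt_prior1 \<tau> \<xi>"
  let ?m = "glt_marginal \<tau> \<xi> y"
  have m: "0 < ?m" by (rule glt_marginal_pos) fact+
  have mt: "?m \<noteq> \<top>"
    using glt_marginal_le_1[OF assms(1,3), of y] by (auto simp: top_unique)
  have "(b - c)\<^sup>2 * normal_density b 1 y
      \<le> 2 * ((b - y)\<^sup>2 * normal_density b 1 y) + 2 * (y - c)\<^sup>2 * normal_density b 1 y" for b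
  proof -
    \<comment> \<open>This square is the exact difference of the two sides of the next
      inequality.\<close>
    have "0 \<le> (b - 2 * y + c)\<^sup>2" by simp
    then have "(b - c)\<^sup>2 \<le> 2 * (b - y)\<^sup>2 + 2 * (y - c)\<^sup>2"
      by (simp add: power2_eq_square algebra_simps)
    then have "(b - c)\<^sup>2 * normal_density b 1 y \<le> (2 * (b - y)\<^sup>2 + 2 * (y - c)\<^sup>2) * normal_density b 1 y"
      by (intro mult_right_mono) auto
    then show ?thesis by (simp add: algebra_simps)
  qed
  then have "?N c \<le> (\<integral>\<^sup>+b. ennreal 2 * ennreal ((b - y)\<^sup>2 * normal_density b 1 y)
      + ennreal (2 * (y - c)\<^sup>2) * ennreal (normal_density b 1 y) \<partial>glt_prior1 \<tau> \<xi>)"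
    by (intro nn_integral_mono)
      (simp add: ennreal_leI del: ennreal_numeral flip: ennreal_mult ennreal_plus)
  also have "\<dots> = 2 * ?N y + ennreal (2 * (y - c)\<^sup>2) * ?m"
    by (subst nn_integral_add) (auto simp: nn_integral_cmult glt_marginal_def)
  finally have "?N c / ?m \<le> (2 * ?N y + ennreal (2 * (y - c)\<^sup>2) * ?m) / ?m"
    by (rule divide_right_mono_ennreal)
  also have "\<dots> = 2 * (?N y / ?m) + ennreal (2 * (y - c)\<^sup>2)"
    using m mt by (simp add: add_divide_distrib_ennreal mult_divide_eq_ennreal ennreal_times_divide)
  finally show ?thesis by (simp add: glt_risk_def)
qed

text \<open>The observation error \<open>2 * (y - c)\<^sup>2\<close> has mean 2 under the true law,
  and \<open>L \<ge> 1\<close> absorbs it; hence the constant \<open>2 * C + 2\<close>.\<close>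

lemma nn_integral_glt_risk_le:
  assumes "1 / 2 < \<xi>"
  obtains C where "0 < C"
    "\<And>\<tau> c. 0 < \<tau> \<Longrightarrow> \<tau> \<le> 1 \<Longrightarrow>
      (\<integral>\<^sup>+y. glt_risk \<tau> \<xi> c y \<partial>normal_dist c 1) \<le> ennreal (C * (1 + ln (1 / \<tau>)))"
proof -
  obtain C where C: "0 < C"
    "\<And>\<tau> y. 0 < \<tau> \<Longrightarrow> \<tau> \<le> 1 \<Longrightarrow> glt_risk \<tau> \<xi> y y \<le> ennreal (C * (1 + ln (1 / \<tau>)))"
    using glt_risk_self_le[OF assms] by blast
  show ?thesis
  proof (rule that[of "2 * C + 2"])
    fix \<tau> c :: real
    assume \<tau>: "0 < \<tau>" "\<tau> \<le> 1"
    define L where "L = 1 + ln (1 / \<tau>)"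
    have L: "1 \<le> L" using \<tau> by (simp add: L_def)
    interpret prob_space "normal_dist c 1" by (intro prob_space_normal_dist) simp
    have "glt_risk \<tau> \<xi> c y \<le> ennreal (2 * C * L) + ennreal (2 * (y - c)\<^sup>2)" for y
    proof -
      have "2 * glt_risk \<tau> \<xi> y y \<le> 2 * ennreal (C * L)"
        using C(2)[OF \<tau>] by (intro mult_left_mono) (auto simp: L_def)
      also have "\<dots> = ennreal (2 * C * L)"
        using C L by (simp add: ennreal_mult mult.assoc)
      finally show ?thesis
        using glt_risk_le_self[OF \<tau>, of \<xi> c y] assms by (meson add_right_mono dual_order.trans less_trans half_gt_zero zero_less_one)
    qed
    then have "(\<integral>\<^sup>+y. glt_risk \<tau> \<xi> c y \<partial>normal_dist c 1)
        \<le> (\<integral>\<^sup>+y. ennreal (2 * C * L) + ennreal (2 * (y - c)\<^sup>2) \<partial>normal_dist c 1)"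
      by (intro nn_integral_mono)
    also have "\<dots> = ennreal (2 * C * L) + (\<integral>\<^sup>+y. ennreal (2 * (y - c)\<^sup>2) \<partial>normal_dist c 1)"
      using emeasure_space_1 by (subst nn_integral_add) auto
    also have "(\<integral>\<^sup>+y. ennreal (2 * (y - c)\<^sup>2) \<partial>normal_dist c 1)
        = (\<integral>\<^sup>+y. ennreal 2 * ennreal ((y - c)\<^sup>2 * normal_density c 1 y) \<partial>lborel)"
      unfolding normal_dist_def
      by (subst nn_integral_density) (auto intro!: nn_integral_cong simp: mult_ac simp del: ennreal_numeral simp flip: ennreal_mult)
    also have "\<dots> = ennreal 2"
      by (subst nn_integral_cmult) (auto simp: nn_integral_normal_second_moment)
    also have "ennreal (2 * C * L) + ennreal 2 \<le> ennreal ((2 * C + 2) * L)"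
      using C L by (simp add: algebra_simps ennreal_leI del: ennreal_numeral flip: ennreal_plus)
    finally show "(\<integral>\<^sup>+y. glt_risk \<tau> \<xi> c y \<partial>normal_dist c 1) \<le> ennreal ((2 * C + 2) * (1 + ln (1 / \<tau>)))"
      by (simp add: L_def)
  qed (use C in simp)
qed

section \<open>Risk at zero coefficients\<close>

lemma borel_measurable_glt_marginal:
  assumes "0 < \<tau>" "0 < \<xi>"
  shows "glt_marginal \<tau> \<xi> \<in> borel_measurable borel"
proof -
  interpret prob_space "glt_prior1 \<tau> \<xi>" using assms by (rule prob_space_glt_prior1)
  show ?thesis unfolding glt_marginal_def[abs_def] by measurable
qed

lemma borel_measurable_glt_risk:
  assumes "0 < \<tau>" "0 < \<xi>"
  shows "glt_risk \<tau> \<xi> c \<in> borel_measurable borel"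
proof -
  interpret prob_space "glt_prior1 \<tau> \<xi>" using assms by (rule prob_space_glt_prior1)
  have [measurable]: "glt_marginal \<tau> \<xi> \<in> borel_measurable borel"
    using assms by (rule borel_measurable_glt_marginal)
  show ?thesis unfolding glt_risk_def[abs_def] by measurable
qed

lemma nn_integral_normal_density_eq_1: "0 < \<sigma> \<Longrightarrow> (\<integral>\<^sup>+x. ennreal (normal_density \<mu> \<sigma> x) \<partial>lborel) = 1"
  using prob_space.emeasure_space_1[OF prob_space_normal_density[of \<sigma> \<mu>]]
  by (simp add: emeasure_density)

text \<open>Expanding \<open>\<bar>y\<bar> = T + (\<bar>y\<bar> - T)\<close> and dropping the
  nonnegative cross term. The factor \<open>exp (- T\<^sup>2 / 2)\<close> splits off and leaves a
  full Gaussian density centred at \<open>T\<close> or \<open>- T\<close>.\<close>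

lemma std_normal_density_shift_le:
  assumes "0 \<le> T" "T \<le> \<bar>y\<bar>"
  shows "normal_density 0 1 y
    \<le> exp (- T\<^sup>2 / 2) * (if 0 \<le> y then normal_density T 1 y else normal_density (- T) 1 y)"
proof -
  have "- y\<^sup>2 / 2 \<le> - T\<^sup>2 / 2 + - (\<bar>y\<bar> - T)\<^sup>2 / 2"
    using mult_left_mono[OF assms(2) assms(1)] by (simp add: power2_eq_square algebra_simps)
  then have "exp (- y\<^sup>2 / 2) \<le> exp (- T\<^sup>2 / 2) * exp (- (\<bar>y\<bar> - T)\<^sup>2 / 2)"
    by (simp only: exp_le_cancel_iff flip: exp_add)
  moreover have "(\<bar>y\<bar> - T)\<^sup>2 = (if 0 \<le> y then (y - T)\<^sup>2 else (y + T)\<^sup>2)"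
    by (simp add: power2_eq_square algebra_simps)
  ultimately show ?thesis
    by (auto simp: normal_density_def divide_right_mono split: if_splits)
qed

text \<open>The tail integral is dominated by integrals over the whole line against the two
  Gaussians centred at \<open>T\<close> and \<open>- T\<close>; each contributes
  \<open>3 + 2 * T\<^sup>2\<close> times the exponential factor.\<close>

lemma nn_integral_normal_tail_le:
  assumes "0 \<le> T"
  shows "(\<integral>\<^sup>+y. ennreal ((1 + y\<^sup>2) * normal_density 0 1 y) * indicator {y. T < \<bar>y\<bar>} y \<partial>lborel)
    \<le> ennreal (6 * (1 + T\<^sup>2) * exp (- T\<^sup>2 / 2))"
proof -
  define E where "E = exp (- T\<^sup>2 / 2)"
  define h where "h m y = (1 + 2 * T\<^sup>2) * normal_density m 1 y + 2 * ((y - m)\<^sup>2 * normal_density m 1 y)" for m y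
  have [measurable]: "h m \<in> borel_measurable borel" for m
    unfolding h_def[abs_def] by measurable
  have E: "0 < E" by (simp add: E_def)
  have h0: "0 \<le> h m y" for m y by (simp add: h_def)
  have h: "(\<integral>\<^sup>+y. ennreal (h m y) \<partial>lborel) = ennreal (3 + 2 * T\<^sup>2)" for m
  proof -
    have "(\<integral>\<^sup>+y. ennreal (h m y) \<partial>lborel) = (\<integral>\<^sup>+y. ennreal (1 + 2 * T\<^sup>2) * ennreal (normal_density m 1 y)
        + ennreal 2 * ennreal ((y - m)\<^sup>2 * normal_density m 1 y) \<partial>lborel)"
      by (intro nn_integral_cong) (simp add: h_def del: ennreal_numeral flip: ennreal_mult ennreal_plus)
    also have "\<dots> = ennreal (1 + 2 * T\<^sup>2) * 1 + ennreal 2 * ennreal 1"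
      by (subst nn_integral_add)
        (auto simp: nn_integral_cmult nn_integral_normal_second_moment nn_integral_normal_density_eq_1)
    also have "\<dots> = ennreal (3 + 2 * T\<^sup>2)"
      by (simp del: ennreal_numeral flip: ennreal_plus ennreal_mult)
    finally show ?thesis .
  qed
  have "(1 + y\<^sup>2) * normal_density 0 1 y \<le> E * h T y + E * h (- T) y" if y: "T < \<bar>y\<bar>" for y
  proof -
    define m where "m = (if 0 \<le> y then T else - T)"
    have "normal_density 0 1 y \<le> E * normal_density m 1 y"
      using std_normal_density_shift_le[of T y] assms y by (auto simp: E_def m_def split: if_splits)
    then have "(1 + y\<^sup>2) * normal_density 0 1 y \<le> (1 + y\<^sup>2) * (E * normal_density m 1 y)"
      by (intro mult_left_mono) auto
    also have "\<dots> \<le> (1 + 2 * T\<^sup>2 + 2 * (y - m)\<^sup>2) * (E * normal_density m 1 y)"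
    proof (intro mult_right_mono)
      \<comment> \<open>The square encodes
        \<open>y\<^sup>2 \<le> 2 * m\<^sup>2 + 2 * (y - m)\<^sup>2\<close>.\<close>
      have "0 \<le> (y - 2 * m)\<^sup>2" "m\<^sup>2 = T\<^sup>2" by (auto simp: m_def)
      then show "1 + y\<^sup>2 \<le> 1 + 2 * T\<^sup>2 + 2 * (y - m)\<^sup>2"
        by (simp add: power2_eq_square algebra_simps)
    qed (use E in auto)
    also have "\<dots> = E * h m y" by (simp add: h_def algebra_simps)
    also have "\<dots> \<le> E * h T y + E * h (- T) y"
      using E h0 by (auto simp: m_def)
    finally show ?thesis .
  qed
  then have "(\<integral>\<^sup>+y. ennreal ((1 + y\<^sup>2) * normal_density 0 1 y) * indicator {y. T < \<bar>y\<bar>} y \<partial>lborel)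
      \<le> (\<integral>\<^sup>+y. ennreal E * ennreal (h T y) + ennreal E * ennreal (h (- T) y) \<partial>lborel)"
    using E h0 by (intro nn_integral_mono) (auto simp: indicator_def ennreal_leI simp flip: ennreal_plus ennreal_mult)
  also have "\<dots> = ennreal E * ennreal (3 + 2 * T\<^sup>2) + ennreal E * ennreal (3 + 2 * T\<^sup>2)"
    by (subst nn_integral_add) (simp_all add: nn_integral_cmult h)
  also have "\<dots> = ennreal (E * (6 + 4 * T\<^sup>2))"
    using E by (simp add: algebra_simps flip: ennreal_plus ennreal_mult)
  also have "\<dots> \<le> ennreal (6 * (1 + T\<^sup>2) * E)"
    using E by (intro ennreal_leI) (simp add: algebra_simps)
  finally show ?thesis by (simp add: E_def)
qed

text \<open>Integrating over \<open>y\<close> first removes the normal density and leaves the prior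
  mean of the shrinkage factor. That factor is at most \<open>l powr p\<close>: by
  \<open>p \<le> 2\<close> for \<open>l \<le> 1\<close>, and because it never exceeds 1 for larger
  \<open>l\<close>. The condition \<open>p < 1 / \<xi>\<close> makes the moment finite.\<close>

lemma nn_integral_shrinkage_le:
  assumes "0 < \<tau>" "0 < \<xi>" "0 < p" "p < 1 / \<xi>" "p \<le> 2"
  shows "(\<integral>\<^sup>+y. \<integral>\<^sup>+l. ennreal (normal_density 0 (sqrt (1 + l\<^sup>2)) y * (l\<^sup>2 / (1 + l\<^sup>2))) \<partial>gpd \<tau> \<xi> \<partial>lborel)
    \<le> ennreal (\<xi> powr (- p) / (1 - p * \<xi>) * \<tau> powr p)"
proof -
  interpret G: prob_space "gpd \<tau> \<xi>" using assms by (intro prob_space_gpd)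
  interpret pair_sigma_finite lborel "gpd \<tau> \<xi>" ..
  have s: "0 < sqrt (1 + l\<^sup>2)" for l :: real by (simp add: add_pos_nonneg)
  have kp: "l\<^sup>2 / (1 + l\<^sup>2) \<le> l powr p" if "0 < l" for l
  proof (cases "l \<le> 1")
    case True
    have "l\<^sup>2 / (1 + l\<^sup>2) \<le> l\<^sup>2 / 1" by (intro divide_left_mono) (auto simp: add_pos_nonneg)
    also have "\<dots> = l powr 2" using that by (simp add: powr_numeral)
    also have "\<dots> \<le> l powr p" using that True assms by (intro powr_mono') auto
    finally show ?thesis .
  next
    case False
    have "l\<^sup>2 / (1 + l\<^sup>2) \<le> 1" by (rule sq_over_one_plus_sq_le_1)
    also have "1 \<le> l powr p" using False assms by (intro ge_one_powr_ge_zero) auto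
    finally show ?thesis .
  qed
  have "(\<integral>\<^sup>+y. \<integral>\<^sup>+l. ennreal (normal_density 0 (sqrt (1 + l\<^sup>2)) y * (l\<^sup>2 / (1 + l\<^sup>2))) \<partial>gpd \<tau> \<xi> \<partial>lborel)
      = (\<integral>\<^sup>+l. \<integral>\<^sup>+y. ennreal (normal_density 0 (sqrt (1 + l\<^sup>2)) y * (l\<^sup>2 / (1 + l\<^sup>2))) \<partial>lborel \<partial>gpd \<tau> \<xi>)"
    by (intro Fubini'[symmetric]) measurable
  also have "\<dots> = (\<integral>\<^sup>+l. ennreal (l\<^sup>2 / (1 + l\<^sup>2)) \<partial>gpd \<tau> \<xi>)"
  proof (intro nn_integral_cong)
    fix l :: real
    show "(\<integral>\<^sup>+y. ennreal (normal_density 0 (sqrt (1 + l\<^sup>2)) y * (l\<^sup>2 / (1 + l\<^sup>2))) \<partial>lborel)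
        = ennreal (l\<^sup>2 / (1 + l\<^sup>2))"
      by (simp add: ennreal_mult nn_integral_multc nn_integral_normal_density_eq_1[OF s] del: times_divide_eq_right)
  qed
  also have "\<dots> \<le> (\<integral>\<^sup>+l. ennreal (l powr p) \<partial>gpd \<tau> \<xi>)"
    using kp by (intro nn_integral_mono_AE eventually_mono[OF AE_gpd_pos]) (auto intro: ennreal_leI)
  also have "\<dots> \<le> ennreal (\<xi> powr (- p) / (1 - p * \<xi>) * \<tau> powr p)"
    using assms by (intro nn_integral_gpd_powr_le) auto
  finally show ?thesis .
qed

text \<open>The shrinkage factor \<open>k\<close> lies in the unit interval, so
  \<open>k\<^sup>2 \<le> k\<close> and variance plus squared bias is at most
  \<open>(1 + y\<^sup>2) * k\<close>. The second bound uses \<open>k \<le> 1\<close>.\<close>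

lemma glt_risk_0_le:
  assumes "0 < \<tau>" "\<tau> \<le> 1" "0 < \<xi>"
  shows "glt_risk \<tau> \<xi> 0 y \<le> ennreal (1 + y\<^sup>2) *
      ((\<integral>\<^sup>+l. ennreal (normal_density 0 (sqrt (1 + l\<^sup>2)) y * (l\<^sup>2 / (1 + l\<^sup>2))) \<partial>gpd \<tau> \<xi>) / glt_marginal \<tau> \<xi> y)"
    and "glt_risk \<tau> \<xi> 0 y \<le> ennreal (1 + y\<^sup>2)"
proof -
  let ?v = "\<lambda>l. normal_density 0 (sqrt (1 + l\<^sup>2)) y"
  let ?K = "\<integral>\<^sup>+l. ennreal (?v l * (l\<^sup>2 / (1 + l\<^sup>2))) \<partial>gpd \<tau> \<xi>"
  let ?N = "\<integral>\<^sup>+l. ennreal (?v l * (l\<^sup>2 / (1 + l\<^sup>2) + (l\<^sup>2 / (1 + l\<^sup>2) * y - 0)\<^sup>2)) \<partial>gpd \<tau> \<xi>"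
  have k: "0 \<le> l\<^sup>2 / (1 + l\<^sup>2)" "l\<^sup>2 / (1 + l\<^sup>2) \<le> 1" for l :: real
    by (simp_all add: sq_over_one_plus_sq_le_1)
  have "?N \<le> (\<integral>\<^sup>+l. ennreal (1 + y\<^sup>2) * ennreal (?v l * (l\<^sup>2 / (1 + l\<^sup>2))) \<partial>gpd \<tau> \<xi>)"
  proof (intro nn_integral_mono)
    fix l :: real
    define k where "k = l\<^sup>2 / (1 + l\<^sup>2)"
    have "0 \<le> k" "k \<le> 1" unfolding k_def by (rule k)+
    then have "k\<^sup>2 \<le> k" by (simp add: power2_eq_square mult_left_le)
    then have "k + (k * y - 0)\<^sup>2 \<le> k + k * y\<^sup>2"
      by (simp add: power_mult_distrib mult_right_mono)
    then have "?v l * (k + (k * y - 0)\<^sup>2) \<le> ?v l * (k + k * y\<^sup>2)"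
      by (intro mult_left_mono) auto
    also have "\<dots> = (1 + y\<^sup>2) * (?v l * k)" by (simp add: algebra_simps)
    finally show "ennreal (?v l * (l\<^sup>2 / (1 + l\<^sup>2) + (l\<^sup>2 / (1 + l\<^sup>2) * y - 0)\<^sup>2))
        \<le> ennreal (1 + y\<^sup>2) * ennreal (?v l * (l\<^sup>2 / (1 + l\<^sup>2)))"
      using k(1)[of l] unfolding k_def[symmetric]
      by (subst ennreal_mult[symmetric]) (auto intro!: ennreal_leI)
  qed
  also have "\<dots> = ennreal (1 + y\<^sup>2) * ?K"
    by (intro nn_integral_cmult) measurable
  finally have N: "?N \<le> ennreal (1 + y\<^sup>2) * ?K" .
  show "glt_risk \<tau> \<xi> 0 y \<le> ennreal (1 + y\<^sup>2) * (?K / glt_marginal \<tau> \<xi> y)"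
    using divide_right_mono_ennreal[OF N] by (simp only: glt_risk_eq ennreal_times_divide)
  have "?K \<le> glt_marginal \<tau> \<xi> y"
    unfolding glt_marginal_eq using k
    by (intro nn_integral_mono ennreal_leI mult_left_le) auto
  then have "?N \<le> ennreal (1 + y\<^sup>2) * glt_marginal \<tau> \<xi> y"
    using N by (meson mult_left_mono order_trans zero_le)
  then show "glt_risk \<tau> \<xi> 0 y \<le> ennreal (1 + y\<^sup>2)"
    unfolding glt_risk_eq using glt_marginal_pos[OF assms]
    by (intro divide_le_posI_ennreal) (auto simp: mult.commute)
qed

text \<open>The first bound of \<open>glt_risk_0_le\<close> serves for
  \<open>\<bar>y\<bar> \<le> T\<close>, the second beyond. The cut \<open>T\<close> stays free so
  that the two errors can be balanced later.\<close>

lemma nn_integral_glt_risk_0_le: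
  assumes "0 < \<xi>" "0 < p" "p < 1 / \<xi>" "p \<le> 2"
  obtains C where "0 < C"
    "\<And>\<tau> T. 0 < \<tau> \<Longrightarrow> \<tau> \<le> 1 \<Longrightarrow> 0 \<le> T \<Longrightarrow>
      (\<integral>\<^sup>+y. glt_risk \<tau> \<xi> 0 y \<partial>normal_dist 0 1)
        \<le> ennreal (C * (1 + T\<^sup>2) * (\<tau> powr p + exp (- T\<^sup>2 / 2)))"
proof
  define c where "c = (1 + \<xi>) powr (- (1 / \<xi> + 1)) / sqrt 2"
  define C where "C = \<xi> powr (- p) / (1 - p * \<xi>)"
  have c: "0 < c" using assms by (simp add: c_def)
  have C: "0 < C" using assms by (simp add: C_def field_simps)
  show "0 < C / c + 6" using c C by (simp add: add_pos_nonneg)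
  fix \<tau> T :: real
  assume \<tau>: "0 < \<tau>" "\<tau> \<le> 1" and T: "0 \<le> T"
  let ?K = "\<lambda>y. \<integral>\<^sup>+l. ennreal (normal_density 0 (sqrt (1 + l\<^sup>2)) y * (l\<^sup>2 / (1 + l\<^sup>2))) \<partial>gpd \<tau> \<xi>"
  let ?\<phi> = "normal_density 0 1"
  interpret G: prob_space "gpd \<tau> \<xi>" using \<tau> assms by (intro prob_space_gpd)
  have [measurable]: "glt_risk \<tau> \<xi> 0 \<in> borel_measurable borel"
    using \<tau> assms by (intro borel_measurable_glt_risk)
  have "ennreal (?\<phi> y) * glt_risk \<tau> \<xi> 0 y \<le> ennreal ((1 + T\<^sup>2) / c) * ?K y
      + ennreal ((1 + y\<^sup>2) * ?\<phi> y) * indicator {y. T < \<bar>y\<bar>} y" for y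
  proof (cases "T < \<bar>y\<bar>")
    case True
    have "ennreal (?\<phi> y) * glt_risk \<tau> \<xi> 0 y \<le> ennreal (?\<phi> y) * ennreal (1 + y\<^sup>2)"
      by (intro mult_left_mono glt_risk_0_le) (use \<tau> assms in auto)
    also have "\<dots> = ennreal ((1 + y\<^sup>2) * ?\<phi> y)"
      by (subst ennreal_mult[symmetric]) (auto simp: mult.commute)
    finally show ?thesis using True by (simp add: add_increasing)
  next
    case False
    then have y: "y\<^sup>2 \<le> T\<^sup>2" using T by (simp add: abs_le_square_iff[symmetric])
    have ge: "ennreal (c * ?\<phi> y) \<le> glt_marginal \<tau> \<xi> y"
      unfolding c_def glt_marginal_eq using \<tau> assms by (intro gpd_marginal_ge_normal)
    have "glt_risk \<tau> \<xi> 0 y \<le> ennreal (1 + y\<^sup>2) * (?K y / glt_marginal \<tau> \<xi> y)"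
      by (intro glt_risk_0_le) (use \<tau> assms in auto)
    \<comment> \<open>Replacing the marginal by its lower bound \<open>c * ?\<phi> y\<close> lets
      the sampling density of \<open>y\<close> cancel, so no quotient is left when Fubini is
      applied.\<close>
    also have "\<dots> \<le> ennreal (1 + T\<^sup>2) * (?K y * ennreal (1 / (c * ?\<phi> y)))"
    proof (intro mult_mono ennreal_leI divide_le_posI_ennreal)
      have "1 = ennreal (c * ?\<phi> y) * ennreal (1 / (c * ?\<phi> y))"
        using c normal_density_pos[of 1 0 y] by (subst ennreal_mult[symmetric]) auto
      also have "\<dots> \<le> glt_marginal \<tau> \<xi> y * ennreal (1 / (c * ?\<phi> y))"
        using ge by (rule mult_right_mono) simp
      finally have "?K y * 1 \<le> ?K y * (glt_marginal \<tau> \<xi> y * ennreal (1 / (c * ?\<phi> y)))"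
        by (rule mult_left_mono) simp
      then show "?K y \<le> glt_marginal \<tau> \<xi> y * (?K y * ennreal (1 / (c * ?\<phi> y)))"
        by (simp only: mult_1_right mult.left_commute)
    qed (use y \<tau> assms glt_marginal_pos in auto)
    finally have "ennreal (?\<phi> y) * glt_risk \<tau> \<xi> 0 y
        \<le> ennreal (?\<phi> y) * (ennreal (1 + T\<^sup>2) * (?K y * ennreal (1 / (c * ?\<phi> y))))"
      by (rule mult_left_mono) simp
    also have "\<dots> = ennreal ((1 + T\<^sup>2) / c) * ?K y"
    proof -
      have "?\<phi> y * ((1 + T\<^sup>2) * (1 / (c * ?\<phi> y))) = (1 + T\<^sup>2) / c"
        using c normal_density_pos[of 1 0 y] by simp
      then have "ennreal ((1 + T\<^sup>2) / c) = ennreal (?\<phi> y * ((1 + T\<^sup>2) * (1 / (c * ?\<phi> y))))"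
        by simp
      also have "\<dots> = ennreal (?\<phi> y) * (ennreal (1 + T\<^sup>2) * ennreal (1 / (c * ?\<phi> y)))"
        using c by (simp only: ennreal_mult normal_density_nonneg mult_nonneg_nonneg add_nonneg_nonneg
          zero_le_power2 zero_le_one divide_nonneg_nonneg less_imp_le)
      finally show ?thesis by (simp only: mult_ac)
    qed
    finally show ?thesis using False by simp
  qed
  then have "(\<integral>\<^sup>+y. glt_risk \<tau> \<xi> 0 y \<partial>normal_dist 0 1) \<le> (\<integral>\<^sup>+y. ennreal ((1 + T\<^sup>2) / c) * ?K y
      + ennreal ((1 + y\<^sup>2) * ?\<phi> y) * indicator {y. T < \<bar>y\<bar>} y \<partial>lborel)"
    unfolding normal_dist_def by (subst nn_integral_density) (auto intro!: nn_integral_mono)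
  also have "\<dots> = ennreal ((1 + T\<^sup>2) / c) * (\<integral>\<^sup>+y. ?K y \<partial>lborel)
      + (\<integral>\<^sup>+y. ennreal ((1 + y\<^sup>2) * ?\<phi> y) * indicator {y. T < \<bar>y\<bar>} y \<partial>lborel)"
    by (subst nn_integral_add) (auto simp: nn_integral_cmult)
  also have "\<dots> \<le> ennreal ((1 + T\<^sup>2) / c) * ennreal (C * \<tau> powr p)
      + ennreal (6 * (1 + T\<^sup>2) * exp (- T\<^sup>2 / 2))"
    unfolding C_def using \<tau> T assms
    by (intro add_mono mult_left_mono nn_integral_shrinkage_le nn_integral_normal_tail_le) auto
  also have "\<dots> = ennreal ((1 + T\<^sup>2) / c * (C * \<tau> powr p) + 6 * (1 + T\<^sup>2) * exp (- T\<^sup>2 / 2))"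
    using c C by (simp flip: ennreal_mult ennreal_plus)
  also have "\<dots> \<le> ennreal ((C / c + 6) * (1 + T\<^sup>2) * (\<tau> powr p + exp (- T\<^sup>2 / 2)))"
  proof (rule ennreal_leI)
    have "(C / c + 6) * (1 + T\<^sup>2) * (\<tau> powr p + exp (- T\<^sup>2 / 2))
        - ((1 + T\<^sup>2) / c * (C * \<tau> powr p) + 6 * (1 + T\<^sup>2) * exp (- T\<^sup>2 / 2))
        = (1 + T\<^sup>2) * (C / c * exp (- T\<^sup>2 / 2) + 6 * \<tau> powr p)"
      using c by (simp add: algebra_simps add_divide_distrib)
    also have "0 \<le> \<dots>" using c C by simp
    finally show "(1 + T\<^sup>2) / c * (C * \<tau> powr p) + 6 * (1 + T\<^sup>2) * exp (- T\<^sup>2 / 2)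
        \<le> (C / c + 6) * (1 + T\<^sup>2) * (\<tau> powr p + exp (- T\<^sup>2 / 2))"
      by (simp only: diff_ge_0_iff_ge)
  qed
  finally show "(\<integral>\<^sup>+y. glt_risk \<tau> \<xi> 0 y \<partial>normal_dist 0 1)
      \<le> ennreal ((C / c + 6) * (1 + T\<^sup>2) * (\<tau> powr p + exp (- T\<^sup>2 / 2)))" .
qed

section \<open>From one coordinate to the joint posterior\<close>

text \<open>Prior and likelihood are products, so the coordinates other than \<open>i\<close>
  contribute the same factor to the numerator and to the evidence.\<close>

lemma nn_integral_glt_posterior_sq:
  assumes \<tau>: "0 < \<tau>" "\<tau> \<le> 1" "0 < \<xi>" and i: "i < n"
  shows "(\<integral>\<^sup>+\<beta>. ennreal ((\<beta> i - c)\<^sup>2) \<partial>glt_posterior n \<tau> \<xi> y) = glt_risk \<tau> \<xi> c (y i)"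
proof -
  interpret P1: prob_space "glt_prior1 \<tau> \<xi>" using \<tau> by (intro prob_space_glt_prior1)
  interpret P: product_sigma_finite "\<lambda>_::nat. glt_prior1 \<tau> \<xi>"
    by standard
  let ?P = "glt_prior n \<tau> \<xi>"
  let ?Z = "\<integral>b. likelihood n y b \<partial>?P"
  let ?m = "\<lambda>j. glt_marginal \<tau> \<xi> (y j)"
  let ?N = "\<integral>\<^sup>+b. ennreal ((b - c)\<^sup>2 * normal_density b 1 (y i)) \<partial>glt_prior1 \<tau> \<xi>"
  let ?r = "\<Prod>j\<in>{..<n} - {i}. ?m j"
  have Z: "ennreal ?Z = (\<Prod>j<n. ?m j)"
  proof -
    have "ennreal ?Z = (\<integral>\<^sup>+b. ennreal (likelihood n y b) \<partial>?P)"
      using \<tau> by (intro nn_integral_eq_integral[symmetric] integrable_likelihood)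
        (auto simp: likelihood_pos less_imp_le)
    also have "\<dots> = (\<integral>\<^sup>+b. (\<Prod>j\<in>{..<n}. ennreal (normal_density (b j) 1 (y j))) \<partial>(\<Pi>\<^sub>M j\<in>{..<n}. glt_prior1 \<tau> \<xi>))"
      by (simp add: likelihood_def glt_prior_def prod_ennreal)
    also have "\<dots> = (\<Prod>j<n. ?m j)"
      unfolding glt_marginal_def
      by (rule P.product_nn_integral_prod[of "{..<n}" "\<lambda>j b. ennreal (normal_density b 1 (y j))"]) auto
    finally show ?thesis .
  qed
  have N: "(\<integral>\<^sup>+b. ennreal (likelihood n y b * (b i - c)\<^sup>2) \<partial>?P) = ?N * ?r"
  proof -
    \<comment> \<open>Attaching the squared error to factor \<open>i\<close> makes the integrand a
      product over coordinates.\<close>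
    let ?f = "\<lambda>j b. ennreal ((if j = i then (b - c)\<^sup>2 else 1) * normal_density b 1 (y j))"
    have "ennreal (likelihood n y b * (b i - c)\<^sup>2) = (\<Prod>j\<in>{..<n}. ?f j (b j))" for b
    proof -
      have "(\<Prod>j\<in>{..<n}. (if j = i then (b j - c)\<^sup>2 else 1) * normal_density (b j) 1 (y j))
          = likelihood n y b * (b i - c)\<^sup>2"
        using i by (simp add: prod.distrib likelihood_def prod.delta)
      moreover have "(\<Prod>j\<in>{..<n}. ?f j (b j))
          = ennreal (\<Prod>j\<in>{..<n}. (if j = i then (b j - c)\<^sup>2 else 1) * normal_density (b j) 1 (y j))"
        by (rule prod_ennreal) simp
      ultimately show ?thesis by simp
    qed
    then have "(\<integral>\<^sup>+b. ennreal (likelihood n y b * (b i - c)\<^sup>2) \<partial>?P)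
        = (\<integral>\<^sup>+b. (\<Prod>j\<in>{..<n}. ?f j (b j)) \<partial>(\<Pi>\<^sub>M j\<in>{..<n}. glt_prior1 \<tau> \<xi>))"
      by (simp add: glt_prior_def)
    also have "\<dots> = (\<Prod>j\<in>{..<n}. \<integral>\<^sup>+b. ?f j b \<partial>glt_prior1 \<tau> \<xi>)"
      by (rule P.product_nn_integral_prod[of "{..<n}" ?f]) auto
    also have "\<dots> = ?N * (\<Prod>j\<in>{..<n} - {i}. \<integral>\<^sup>+b. ?f j b \<partial>glt_prior1 \<tau> \<xi>)"
      using i by (subst prod.remove[of _ i]) auto
    also have "(\<Prod>j\<in>{..<n} - {i}. \<integral>\<^sup>+b. ?f j b \<partial>glt_prior1 \<tau> \<xi>) = ?r"
      by (intro prod.cong) (auto simp: glt_marginal_def)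
    finally show ?thesis .
  qed
  have m: "0 < ?m j" "?m j \<noteq> \<top>" for j
    using glt_marginal_pos[OF \<tau>] glt_marginal_le_1[OF \<tau>(1,3), of "y j"] by (auto simp: top_unique)
  \<comment> \<open>Cancelling a common factor in \<open>ennreal\<close> requires it to be neither 0
    nor infinite.\<close>
  have r: "?r \<noteq> 0" "?r \<noteq> \<top>"
    using m by (auto simp: ennreal_prod_eq_top less_le)
  have [measurable]: "likelihood n y \<in> borel_measurable ?P" "(\<lambda>b. b i) \<in> borel_measurable ?P"
    unfolding measurable_cong_sets[OF sets_glt_prior refl]
    using i by (auto intro: likelihood_measurable2 measurable_component_singleton)
  have "(\<integral>\<^sup>+\<beta>. ennreal ((\<beta> i - c)\<^sup>2) \<partial>glt_posterior n \<tau> \<xi> y)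
      = (\<integral>\<^sup>+\<beta>. ennreal (likelihood n y \<beta> * (\<beta> i - c)\<^sup>2) / ennreal ?Z \<partial>?P)"
    unfolding glt_posterior_def
    using evidence_pos[OF \<tau>(1,3), of n y]
    by (subst nn_integral_density)
      (auto intro!: nn_integral_cong simp: divide_ennreal likelihood_pos less_imp_le simp flip: ennreal_mult)
  also have "\<dots> = (\<integral>\<^sup>+\<beta>. ennreal (likelihood n y \<beta> * (\<beta> i - c)\<^sup>2) \<partial>?P) / ennreal ?Z"
    by (rule nn_integral_divide) simp
  also have "\<dots> = ?N * ?r / (?m i * ?r)"
    unfolding N Z using i by (subst prod.remove[of "{..<n}" i]) auto
  also have "\<dots> = ?N / ?m i"
    using r by (intro divide_mult_eq) auto
  finally show ?thesis by (simp add: glt_risk_def)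
qed

lemma nn_integral_glt_posterior_sq_dist:
  assumes "0 < \<tau>" "\<tau> \<le> 1" "0 < \<xi>"
  shows "(\<integral>\<^sup>+\<beta>. ennreal (sq_dist n \<beta> \<theta>) \<partial>glt_posterior n \<tau> \<xi> y) = (\<Sum>i<n. glt_risk \<tau> \<xi> (\<theta> i) (y i))"
proof -
  have m: "(\<lambda>\<beta>. \<beta> i) \<in> borel_measurable (glt_posterior n \<tau> \<xi> y)" if "i < n" for i
    unfolding measurable_cong_sets[OF sets_glt_posterior refl]
    using that by (intro measurable_component_singleton) simp
  have "(\<integral>\<^sup>+\<beta>. ennreal (sq_dist n \<beta> \<theta>) \<partial>glt_posterior n \<tau> \<xi> y)
      = (\<integral>\<^sup>+\<beta>. (\<Sum>i<n. ennreal ((\<beta> i - \<theta> i)\<^sup>2)) \<partial>glt_posterior n \<tau> \<xi> y)"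
    by (simp add: sq_dist_def sum_ennreal)
  also have "\<dots> = (\<Sum>i<n. \<integral>\<^sup>+\<beta>. ennreal ((\<beta> i - \<theta> i)\<^sup>2) \<partial>glt_posterior n \<tau> \<xi> y)"
    using m by (intro nn_integral_sum) (auto intro!: borel_measurable_power borel_measurable_diff)
  also have "\<dots> = (\<Sum>i<n. glt_risk \<tau> \<xi> (\<theta> i) (y i))"
    using assms by (intro sum.cong nn_integral_glt_posterior_sq) auto
  finally show ?thesis .
qed

lemma measurable_glt_risk_component:
  assumes "0 < \<tau>" "0 < \<xi>" "i < n"
  shows "(\<lambda>y. glt_risk \<tau> \<xi> c (y i)) \<in> borel_measurable (normal_means n \<theta>)"
proof -
  have "(\<lambda>y. y i) \<in> borel_measurable (normal_means n \<theta>)"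
    unfolding measurable_cong_sets[OF sets_normal_means refl]
    using assms by (intro measurable_component_singleton) simp
  then show ?thesis
    using assms by (intro measurable_compose[OF _ borel_measurable_glt_risk])
qed

lemma nn_integral_normal_means_component:
  assumes "f \<in> borel_measurable borel" "i < n"
  shows "(\<integral>\<^sup>+y. f (y i) \<partial>normal_means n \<theta>) = (\<integral>\<^sup>+y. f y \<partial>normal_dist (\<theta> i) 1)"
proof -
  have eq: "normal_dist (\<theta> i) 1 = distr (normal_means n \<theta>) (normal_dist (\<theta> i) 1) (\<lambda>y. y i)"
    using assms unfolding normal_means_def
    by (intro distr_PiM_component[symmetric] prob_space_normal_dist) auto
  have m: "(\<lambda>y. y i) \<in> normal_means n \<theta> \<rightarrow>\<^sub>M normal_dist (\<theta> i) 1"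
    unfolding measurable_cong_sets[OF sets_normal_means sets_normal_dist]
    using assms by (intro measurable_component_singleton) simp
  have f: "f \<in> borel_measurable (normal_dist (\<theta> i) 1)"
    unfolding measurable_cong_sets[OF sets_normal_dist refl] by fact
  show ?thesis
    by (subst eq, subst nn_integral_distr[OF m]) (simp_all add: f)
qed

text \<open>Markov's inequality for each fixed \<open>y\<close>, then linearity of the expectation;
  each coordinate risk depends on \<open>y i\<close> alone, whose law is the corresponding normal
  marginal.\<close>

lemma expected_glt_posterior_prob_le:
  assumes "0 < \<tau>" "\<tau> \<le> 1" "0 < \<xi>" "0 < D" "0 \<le> B"
    and B: "(\<Sum>i<n. \<integral>\<^sup>+y. glt_risk \<tau> \<xi> (\<theta> i) y \<partial>normal_dist (\<theta> i) 1) \<le> ennreal B"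
  shows "(\<integral>y. \<P>(\<beta> in glt_posterior n \<tau> \<xi> y. D \<le> sq_dist n \<beta> \<theta>) \<partial>normal_means n \<theta>) \<le> B / D"
proof -
  let ?A = "{\<beta> \<in> space (\<Pi>\<^sub>M i\<in>{..<n}. borel). D \<le> sq_dist n \<beta> \<theta>}"
  have sq: "(\<lambda>\<beta>. sq_dist n \<beta> \<theta>) \<in> borel_measurable (\<Pi>\<^sub>M i\<in>{..<n}. borel)"
    unfolding sq_dist_def
    by (intro borel_measurable_sum borel_measurable_power borel_measurable_diff
        borel_measurable_const measurable_component_singleton)
  have sp: "space (glt_posterior n \<tau> \<xi> y) = space (\<Pi>\<^sub>M i\<in>{..<n}. borel)" for y
    by (rule sets_eq_imp_space_eq[OF sets_glt_posterior])
  have A: "?A \<in> sets (\<Pi>\<^sub>M i\<in>{..<n}. borel)"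
    using sq by measurable
  have "ennreal (measure (glt_posterior n \<tau> \<xi> y) ?A)
      \<le> ennreal (1 / D) * (\<Sum>i<n. glt_risk \<tau> \<xi> (\<theta> i) (y i))" for y
  proof -
    interpret prob_space "glt_posterior n \<tau> \<xi> y" using assms by (intro prob_space_glt_posterior)
    let ?u = "\<lambda>\<beta>. ennreal (sq_dist n \<beta> \<theta>)" and ?S = "space (glt_posterior n \<tau> \<xi> y)"
    have 1: "1 \<le> ennreal (1 / D) * ?u \<beta> \<longleftrightarrow> D \<le> sq_dist n \<beta> \<theta>" for \<beta>
      using \<open>0 < D\<close> unfolding ennreal_1[symmetric]
      by (subst ennreal_mult[symmetric]) (auto simp: sq_dist_def sum_nonneg)
    have u: "?u \<in> borel_measurable (glt_posterior n \<tau> \<xi> y)"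
      unfolding measurable_cong_sets[OF sets_glt_posterior refl] using sq by measurable
    have "ennreal (measure (glt_posterior n \<tau> \<xi> y) ?A) = emeasure (glt_posterior n \<tau> \<xi> y) {\<beta> \<in> ?S. 1 \<le> ennreal (1 / D) * ?u \<beta>}"
      unfolding 1 sp by (rule emeasure_eq_measure[symmetric])
    also have "\<dots> \<le> ennreal (1 / D) * (\<integral>\<^sup>+\<beta>. ?u \<beta> * indicator ?S \<beta> \<partial>glt_posterior n \<tau> \<xi> y)"
      by (intro nn_integral_Markov_inequality borel_measurable_times_ennreal u
          borel_measurable_indicator sets.top)
    also have "(\<integral>\<^sup>+\<beta>. ?u \<beta> * indicator ?S \<beta> \<partial>glt_posterior n \<tau> \<xi> y) = (\<integral>\<^sup>+\<beta>. ?u \<beta> \<partial>glt_posterior n \<tau> \<xi> y)"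
      by (rule nn_integral_cong) simp
    finally show ?thesis
      unfolding nn_integral_glt_posterior_sq_dist[OF assms(1-3)] .
  qed
  then have "(\<integral>\<^sup>+y. ennreal (measure (glt_posterior n \<tau> \<xi> y) ?A) \<partial>normal_means n \<theta>)
      \<le> (\<integral>\<^sup>+y. ennreal (1 / D) * (\<Sum>i<n. glt_risk \<tau> \<xi> (\<theta> i) (y i)) \<partial>normal_means n \<theta>)"
    by (intro nn_integral_mono)
  also have "\<dots> = ennreal (1 / D) * (\<integral>\<^sup>+y. (\<Sum>i<n. glt_risk \<tau> \<xi> (\<theta> i) (y i)) \<partial>normal_means n \<theta>)"
    using assms by (intro nn_integral_cmult borel_measurable_sum measurable_glt_risk_component) auto
  also have "(\<integral>\<^sup>+y. (\<Sum>i<n. glt_risk \<tau> \<xi> (\<theta> i) (y i)) \<partial>normal_means n \<theta>)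
      = (\<Sum>i<n. \<integral>\<^sup>+y. glt_risk \<tau> \<xi> (\<theta> i) (y i) \<partial>normal_means n \<theta>)"
    using assms by (intro nn_integral_sum measurable_glt_risk_component) auto
  also have "\<dots> = (\<Sum>i<n. \<integral>\<^sup>+y. glt_risk \<tau> \<xi> (\<theta> i) y \<partial>normal_dist (\<theta> i) 1)"
    using assms by (intro sum.cong refl nn_integral_normal_means_component borel_measurable_glt_risk) auto
  also have "ennreal (1 / D) * \<dots> \<le> ennreal (1 / D) * ennreal B"
    using B by (rule mult_left_mono) simp
  also have "\<dots> = ennreal (B / D)"
    using assms by (subst ennreal_mult[symmetric]) auto
  finally have le: "(\<integral>\<^sup>+y. ennreal (measure (glt_posterior n \<tau> \<xi> y) ?A) \<partial>normal_means n \<theta>) \<le> ennreal (B / D)" .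
  \<comment> \<open>Posterior probabilities are measurable in \<open>y\<close>, so the Bochner
    integral can be read off the nonnegative one.\<close>
  have "(\<integral>y. measure (glt_posterior n \<tau> \<xi> y) ?A \<partial>normal_means n \<theta>)
      = enn2real (\<integral>\<^sup>+y. ennreal (measure (glt_posterior n \<tau> \<xi> y) ?A) \<partial>normal_means n \<theta>)"
  proof (rule integral_eq_nn_integral)
    show "(\<lambda>y. measure (glt_posterior n \<tau> \<xi> y) ?A) \<in> borel_measurable (normal_means n \<theta>)"
      unfolding measurable_cong_sets[OF sets_normal_means refl]
      using assms A by (intro measurable_posterior_prob)
  qed simp
  also have "\<dots> \<le> B / D"
    using le assms by (intro enn2real_leI) auto
  finally show ?thesis unfolding sp .
qed

section \<open>Total risk and posterior contraction\<close>

text \<open>The \<open>k\<close> signals cost \<open>O(L)\<close> each, and every coordinate is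
  charged a noise risk \<open>O(L * k / n)\<close>; both totals are of order
  \<open>k * L\<close>.\<close>

lemma sum_glt_risk_le:
  assumes "1 / 2 < \<alpha>" "1 / 2 < \<xi>" "\<xi> < \<alpha>"
  obtains C where "0 < C"
    "\<And>n k \<theta>. 0 < k \<Longrightarrow> 1 \<le> ln (real n / real k) \<Longrightarrow> card {i. i < n \<and> \<theta> i \<noteq> 0} = k \<Longrightarrow>
      (\<Sum>i<n. \<integral>\<^sup>+y. glt_risk ((real k / real n) powr \<alpha>) \<xi> (\<theta> i) y \<partial>normal_dist (\<theta> i) 1)
        \<le> ennreal (C * real k * ln (real n / real k))"
proof -
  \<comment> \<open>This exponent undoes the choice of the global scale:
    \<open>\<tau> powr p = k / n\<close>. It is admissible because \<open>\<xi> < \<alpha>\<close>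
    and \<open>\<alpha> > 1/2\<close>.\<close>
  define p where "p = 1 / \<alpha>"
  have \<alpha>: "0 < \<alpha>" and \<xi>: "0 < \<xi>" using assms by auto
  have p: "0 < p" "p < 1 / \<xi>" "p \<le> 2"
    using assms \<alpha> \<xi> by (auto simp: p_def field_simps)
  obtain C1 where C1: "0 < C1"
    "\<And>\<tau> c. 0 < \<tau> \<Longrightarrow> \<tau> \<le> 1 \<Longrightarrow>
      (\<integral>\<^sup>+y. glt_risk \<tau> \<xi> c y \<partial>normal_dist c 1) \<le> ennreal (C1 * (1 + ln (1 / \<tau>)))"
    using nn_integral_glt_risk_le[OF assms(2)] by blast
  obtain C2 where C2: "0 < C2"
    "\<And>\<tau> T. 0 < \<tau> \<Longrightarrow> \<tau> \<le> 1 \<Longrightarrow> 0 \<le> T \<Longrightarrow>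
      (\<integral>\<^sup>+y. glt_risk \<tau> \<xi> 0 y \<partial>normal_dist 0 1)
        \<le> ennreal (C2 * (1 + T\<^sup>2) * (\<tau> powr p + exp (- T\<^sup>2 / 2)))"
    using nn_integral_glt_risk_0_le[OF \<xi> p] by blast
  show ?thesis
  proof (rule that[of "C1 * (1 + \<alpha>) + 6 * C2"])
    show "0 < C1 * (1 + \<alpha>) + 6 * C2" using C1(1) C2(1) \<alpha> by (simp add: add_pos_pos)
    fix n k :: nat and \<theta> :: "nat \<Rightarrow> real"
    assume k: "0 < k" and l: "1 \<le> ln (real n / real k)" and card: "card {i. i < n \<and> \<theta> i \<noteq> 0} = k"
    define L where "L = ln (real n / real k)"
    define r where "r = real k / real n"
    define \<tau> where "\<tau> = r powr \<alpha>"
    define A where "A = C1 * (1 + \<alpha>) * L"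
    define B where "B = 6 * C2 * L * r"
    have L: "1 \<le> L" using l by (simp add: L_def)
    have n: "0 < n" using l by (cases n) auto
    have r: "0 < r" using k n by (simp add: r_def)
    have lnr: "ln r = - L" using k n by (simp add: r_def L_def ln_div)
    then have r1: "r \<le> 1" using r L by (simp flip: ln_le_zero_iff)
    have \<tau>: "0 < \<tau>" "\<tau> \<le> 1"
      using r r1 \<alpha> by (auto simp: \<tau>_def powr_le1)
    have ln\<tau>: "ln (1 / \<tau>) = \<alpha> * L"
      using r lnr by (simp add: \<tau>_def ln_div ln_powr)
    have A0: "0 \<le> A" and B0: "0 \<le> B"
      using C1(1) C2(1) \<alpha> L r by (auto simp: A_def B_def)
    have A_le: "(\<integral>\<^sup>+y. glt_risk \<tau> \<xi> c y \<partial>normal_dist c 1) \<le> ennreal A" for c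
    proof -
      have "C1 * (1 + \<alpha> * L) \<le> A"
        using C1(1) L by (simp add: A_def distrib_right mult.assoc)
      then show ?thesis
        using C1(2)[OF \<tau>, of c] unfolding ln\<tau> by (meson ennreal_leI order_trans)
    qed
    \<comment> \<open>With \<open>T = sqrt (2 * L)\<close> the Gaussian tail term equals
      \<open>r\<close>, the same as \<open>\<tau> powr p\<close>. The 6 in \<open>B\<close> comes
      from \<open>1 + 2 * L \<le> 3 * L\<close> and \<open>r + r\<close>.\<close>
    have *: "(\<integral>\<^sup>+y. glt_risk \<tau> \<xi> 0 y \<partial>normal_dist 0 1) \<le> ennreal B"
    proof -
      have "\<tau> powr p = r" using r \<alpha> by (simp add: \<tau>_def p_def powr_powr)
      moreover have "(sqrt (2 * L))\<^sup>2 = 2 * L" using L by simp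
      moreover have "exp (- (2 * L) / 2) = r"
        using r lnr by (simp add: exp_minus) (metis exp_ln exp_minus)
      ultimately have "(\<integral>\<^sup>+y. glt_risk \<tau> \<xi> 0 y \<partial>normal_dist 0 1) \<le> ennreal (C2 * (1 + 2 * L) * (r + r))"
        using C2(2)[OF \<tau>, of "sqrt (2 * L)"] L by simp
      also have "C2 * (1 + 2 * L) * (r + r) \<le> C2 * (3 * L) * (r + r)"
        using C2(1) L r by (intro mult_right_mono mult_left_mono) auto
      also have "\<dots> = B" by (simp add: B_def)
      finally show ?thesis by (simp add: ennreal_leI)
    qed
    have le: "(\<integral>\<^sup>+y. glt_risk \<tau> \<xi> (\<theta> i) y \<partial>normal_dist (\<theta> i) 1)
        \<le> ennreal (A * of_bool (\<theta> i \<noteq> 0) + B)" for i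
    proof (cases "\<theta> i = 0")
      case True
      then show ?thesis using * by simp
    next
      case False
      have "ennreal A \<le> ennreal (A * of_bool (\<theta> i \<noteq> 0) + B)"
        using False B0 by (intro ennreal_leI) simp
      then show ?thesis using A_le[of "\<theta> i"] by (rule order_trans[rotated])
    qed
    have "(\<Sum>i<n. \<integral>\<^sup>+y. glt_risk \<tau> \<xi> (\<theta> i) y \<partial>normal_dist (\<theta> i) 1)
        \<le> (\<Sum>i<n. ennreal (A * of_bool (\<theta> i \<noteq> 0) + B))"
      by (intro sum_mono le)
    also have "\<dots> = ennreal (\<Sum>i<n. A * of_bool (\<theta> i \<noteq> 0) + B)"
      using A0 B0 by (intro sum_ennreal) simp
    also have "(\<Sum>i<n. A * of_bool (\<theta> i \<noteq> 0) + B) = A * real k + real n * B"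
    proof -
      have "{..<n} \<inter> {i. \<theta> i \<noteq> 0} = {i. i < n \<and> \<theta> i \<noteq> 0}" by auto
      then show ?thesis
        using card by (simp add: sum.distrib sum_of_bool_eq flip: sum_distrib_left)
    qed
    also have "\<dots> = (C1 * (1 + \<alpha>) + 6 * C2) * real k * L"
      using n by (simp add: A_def B_def r_def algebra_simps)
    finally show "(\<Sum>i<n. \<integral>\<^sup>+y. glt_risk ((real k / real n) powr \<alpha>) \<xi> (\<theta> i) y \<partial>normal_dist (\<theta> i) 1)
        \<le> ennreal ((C1 * (1 + \<alpha>) + 6 * C2) * real k * ln (real n / real k))"
      by (simp only: \<tau>_def r_def L_def)
  qed
qed

theorem theorem4p7:
  fixes \<alpha> \<xi> :: real
    and q :: "nat \<Rightarrow> nat"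
    and \<beta>\<^sub>0 :: "nat \<Rightarrow> nat \<Rightarrow> real"
    and M :: "nat \<Rightarrow> real"
  assumes "1/2 < \<alpha>" and "1/2 < \<xi>" and "\<xi> < \<alpha>"
    and "\<And>n. 2 \<le> n \<Longrightarrow> 1 \<le> q n \<and> q n < n"
    and "filterlim q at_top sequentially"
    and "(\<lambda>n. real (q n)) \<in> o(\<lambda>n. real n)"
    and "\<And>n. 2 \<le> n \<Longrightarrow> card {i. i < n \<and> \<beta>\<^sub>0 n i \<noteq> 0} = q n"
    and "filterlim M at_top sequentially"
  shows "(\<lambda>n. \<integral>y. \<P>(\<beta> in glt_posterior n ((real (q n) / real n) powr \<alpha>) \<xi> y.
                    sq_dist n \<beta> (\<beta>\<^sub>0 n) \<ge> M n * real (q n) * ln (real n / real (q n)))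
              \<partial>normal_means n (\<beta>\<^sub>0 n)) \<longlonglongrightarrow> 0"
proof -
  obtain C where C: "0 < C"
    "\<And>n k \<theta>. 0 < k \<Longrightarrow> 1 \<le> ln (real n / real k) \<Longrightarrow> card {i. i < n \<and> \<theta> i \<noteq> 0} = k \<Longrightarrow>
      (\<Sum>i<n. \<integral>\<^sup>+y. glt_risk ((real k / real n) powr \<alpha>) \<xi> (\<theta> i) y \<partial>normal_dist (\<theta> i) 1)
        \<le> ennreal (C * real k * ln (real n / real k))"
    using sum_glt_risk_le[OF assms(1-3)] by blast
  let ?f = "\<lambda>n. \<integral>y. \<P>(\<beta> in glt_posterior n ((real (q n) / real n) powr \<alpha>) \<xi> y.
      M n * real (q n) * ln (real n / real (q n)) \<le> sq_dist n \<beta> (\<beta>\<^sub>0 n)) \<partial>normal_means n (\<beta>\<^sub>0 n)"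
  \<comment> \<open>The little-o hypothesis is used with the constant \<open>exp (- 1)\<close>,
    which makes \<open>ln (n / q)\<close> at least 1; \<open>M n > 0\<close> makes the threshold
    positive for Markov's inequality.\<close>
  have upper: "eventually (\<lambda>n. ?f n \<le> C / M n) sequentially"
    using eventually_ge_at_top[of 2] landau_o.smallD[OF assms(6), of "exp (- 1)", OF exp_gt_zero]
      filterlim_at_top_dense[THEN iffD1, OF assms(8), rule_format, of 0]
  proof eventually_elim
    case (elim n)
    define k where "k = q n"
    define L where "L = ln (real n / real k)"
    have k: "0 < k" "k < n" using assms(4)[OF elim(1)] by (auto simp: k_def)
    have "exp 1 * real k \<le> exp 1 * (exp (- 1) * real n)"
      using elim(2) by (intro mult_left_mono) (auto simp: k_def)
    also have "\<dots> = real n" by (simp flip: exp_add)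
    finally have "exp 1 \<le> real n / real k" using k by (simp add: field_simps)
    then have L: "1 \<le> L" using k by (simp add: L_def ln_ge_iff)
    have D: "0 < M n * real k * L" using elim(3) k L by simp
    have "?f n \<le> C * real k * L / (M n * real k * L)"
      unfolding k_def[symmetric] L_def[symmetric]
    proof (rule expected_glt_posterior_prob_le)
      show "0 < (real k / real n) powr \<alpha>" using k by simp
      show "(real k / real n) powr \<alpha> \<le> 1" using k assms(1) by (intro powr_le1) auto
      show "0 < \<xi>" using assms(2) by linarith
      show "0 < M n * real k * L" by (fact D)
      show "0 \<le> C * real k * L" using C(1) L by simp
      show "(\<Sum>i<n. \<integral>\<^sup>+y. glt_risk ((real k / real n) powr \<alpha>) \<xi> (\<beta>\<^sub>0 n i) y \<partial>normal_dist (\<beta>\<^sub>0 n i) 1)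
          \<le> ennreal (C * real k * L)"
        using C(2)[of k n "\<beta>\<^sub>0 n"] k L assms(7)[OF elim(1)] by (simp add: L_def k_def)
    qed
    also have "\<dots> = C / M n" using k L by simp
    finally show ?case .
  qed
  have lower: "eventually (\<lambda>n. 0 \<le> ?f n) sequentially"
    by (intro always_eventually allI Bochner_Integration.integral_nonneg measure_nonneg)
  have lim: "(\<lambda>n. C / M n) \<longlonglongrightarrow> 0"
    using filterlim_at_top_imp_at_infinity[OF assms(8)] by (rule tendsto_divide_0[OF tendsto_const])
  show ?thesis
    by (rule tendsto_sandwich[OF lower upper tendsto_const lim])
qed

end
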